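(* Let $n\geq 5$. The maximum degree of a vertex of the Hasse diagram $H(B_n)$ of the (strong) Bruhat order of the hyperoctahedral group $B_n$ is $$\left\lfloor \frac{n^2}{2}\right\rfloor+n-1.$$
   Context: $B_n$ is the hyperoctahedral group: the group of permutations $\pi$ of $\{\pm1,\ldots,\pm n\}$ such that $\pi(-a)=-\pi(a)$ for all $a$. It is a Coxeter group with Coxeter generators $s_0=(1,-1)$ and $s_i=(i,i+1)(-i,-i-1)$ for $1\le i\le n-1$ (cycle notation). For a Coxeter system $(W,S)$, $\ell$ denotes the length function with respect to $S$ and $T=\bigcup_{w\in W}wSw^{-1}$ the set of reflections. The (strong) Bruhat order on $W$ is the partial order generated by the relations $tw<w$ for $w\in W$, $t\in T$ with $\ell(tw)<\ell(w)$. The Hasse diagram $H(W)$ is the undirected graph with vertex set $W$ in which two elements are joined by an edge if and only if one covers the other in the Bruhat order. The degree of a vertex is its number of neighbours. *)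

theory Defs
  imports Complex_Main "HOL-Combinatorics.Permutations"
begin

text \<open>
  A permutation group is given by its set \<open>W\<close> of elements, as functions under composition, and
  \<open>S\<close> is a generating set of involutions.
\<close>

text \<open>The \<^const>\<open>Least\<close> below is only meaningful for \<open>w\<close> in the group generated by \<open>S\<close>.\<close>

definition cox_length :: "('a \<Rightarrow> 'a) set \<Rightarrow> ('a \<Rightarrow> 'a) \<Rightarrow> nat" where
  "cox_length S w = (LEAST k. \<exists>ss. length ss = k \<and> set ss \<subseteq> S \<and> foldr (\<circ>) ss id = w)"

definition reflections :: "('a \<Rightarrow> 'a) set \<Rightarrow> ('a \<Rightarrow> 'a) set \<Rightarrow> ('a \<Rightarrow> 'a) set" where
  "reflections W S = {w \<circ> s \<circ> inv w |w s. w \<in> W \<and> s \<in> S}"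

definition bruhat_step :: "('a \<Rightarrow> 'a) set \<Rightarrow> ('a \<Rightarrow> 'a) set \<Rightarrow> (('a \<Rightarrow> 'a) \<times> ('a \<Rightarrow> 'a)) set" where
  "bruhat_step W S =
     {(t \<circ> w, w) |t w. t \<in> reflections W S \<and> w \<in> W \<and> cox_length S (t \<circ> w) < cox_length S w}"

definition bruhat_le :: "('a \<Rightarrow> 'a) set \<Rightarrow> ('a \<Rightarrow> 'a) set \<Rightarrow> ('a \<Rightarrow> 'a) \<Rightarrow> ('a \<Rightarrow> 'a) \<Rightarrow> bool" where
  "bruhat_le W S u v \<longleftrightarrow> u \<in> W \<and> v \<in> W \<and> (u, v) \<in> (bruhat_step W S)\<^sup>*"

definition bruhat_less :: "('a \<Rightarrow> 'a) set \<Rightarrow> ('a \<Rightarrow> 'a) set \<Rightarrow> ('a \<Rightarrow> 'a) \<Rightarrow> ('a \<Rightarrow> 'a) \<Rightarrow> bool" where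
  "bruhat_less W S u v \<longleftrightarrow> bruhat_le W S u v \<and> u \<noteq> v"

definition bruhat_covers :: "('a \<Rightarrow> 'a) set \<Rightarrow> ('a \<Rightarrow> 'a) set \<Rightarrow> ('a \<Rightarrow> 'a) \<Rightarrow> ('a \<Rightarrow> 'a) \<Rightarrow> bool" where
  "bruhat_covers W S v u \<longleftrightarrow>
     bruhat_less W S u v \<and> (\<nexists>z. bruhat_less W S u z \<and> bruhat_less W S z v)"

definition hasse_adj :: "('a \<Rightarrow> 'a) set \<Rightarrow> ('a \<Rightarrow> 'a) set \<Rightarrow> ('a \<Rightarrow> 'a) \<Rightarrow> ('a \<Rightarrow> 'a) \<Rightarrow> bool" where
  "hasse_adj W S u v \<longleftrightarrow> bruhat_covers W S u v \<or> bruhat_covers W S v u"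

definition hasse_degree :: "('a \<Rightarrow> 'a) set \<Rightarrow> ('a \<Rightarrow> 'a) set \<Rightarrow> ('a \<Rightarrow> 'a) \<Rightarrow> nat" where
  "hasse_degree W S v = card {u \<in> W. hasse_adj W S v u}"

text \<open>
  Signed permutations act on all of \<open>int\<close>; by \<^const>\<open>permutes\<close> they fix \<open>0\<close> and everything of
  absolute value greater than \<open>n\<close>.
\<close>

definition hyperoctahedral :: "nat \<Rightarrow> (int \<Rightarrow> int) set" where
  "hyperoctahedral n = {p. p permutes ({- int n..int n} - {0}) \<and> (\<forall>a. p (- a) = - p a)}"

definition hyperoctahedral_gens :: "nat \<Rightarrow> (int \<Rightarrow> int) set" where
  "hyperoctahedral_gens n =
     insert (transpose 1 (- 1))
       {transpose i (i + 1) \<circ> transpose (- i) (- i - 1) |i. 1 \<le> i \<and> i \<le> int n - 1}"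

lemma finite_hyperoctahedral: "finite (hyperoctahedral n)"
  by (rule finite_subset[OF _ finite_permutations[of "{- int n..int n} - {0}"]])
    (auto simp: hyperoctahedral_def)

lemma id_in_hyperoctahedral: "id \<in> hyperoctahedral n"
  by (auto simp: hyperoctahedral_def permutes_id)

end

theory Submission
  imports Defs "HOL-Library.Product_Plus"
begin

text \<open>
Write \<open>f(n) = \<lfloor>n\<^sup>2/2\<rfloor> + n - 1\<close>. A signed permutation \<open>w\<close> is plotted as the centrally symmetric set of the
\<open>2n\<close> points \<open>(i, w i)\<close> with \<open>i = \<plusminus>1, \<dots>, \<plusminus>n\<close>. A reflection exchanges the values at two positions
\<open>a\<close>, \<open>b\<close> and, simultaneously, those at \<open>-a\<close>, \<open>-b\<close>, so reflections are unordered pairs of points up to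
the antipodal map. Such a reflection leads to a neighbour of \<open>w\<close> in the Hasse diagram exactly when
the open box spanned by the two points contains no point of the diagram and, unless the two points
are antipodal, does not contain the origin either (\<open>bruhat_covers_iff\<close>). The degree of \<open>w\<close> is
therefore the number of antipodal orbits of such pairs, the \<open>edges\<close> of the diagram
(\<open>hasse_degree_eq\<close>), and the problem becomes a planar one.

The upper bound goes by deleting pairs of antipodal points; deletion never destroys an edge between
surviving points. The engine is \<open>card_common_nbrs\<close>: let \<open>u\<close> be the leftmost point and \<open>v\<close> its
rightmost neighbour. A common neighbour of \<open>u\<close> and \<open>v\<close> lies horizontally between them, hence above
or below their empty box, and of two candidates on the same side one blocks the other. So there are
at most two common neighbours and the degrees of \<open>u\<close> and \<open>v\<close> add up to at most \<open>2n + 2\<close>. Thus some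
point has degree at most \<open>n + 1\<close>, which settles even \<open>n\<close> since \<open>f(n) = f(n - 1) + n + 1\<close>. For odd
\<open>n\<close> one has \<open>f(n) = f(n - 2) + 2n\<close>, and deleting \<open>\<plusminus>u\<close>, \<open>\<plusminus>v\<close> destroys at most \<open>2n\<close> edges
(\<open>leftmost_pair\<close>), unless \<open>v = -u\<close>. The same argument applies to the lowest point \<open>s\<close>. In the
remaining case both extreme points are adjacent to their antipodes; then deleting \<open>\<plusminus>u\<close>, \<open>\<plusminus>s\<close> either
costs at most \<open>2n\<close> edges, or it costs one more but leaves all points in two opposite quadrants, where
the origin blocks so many pairs that a crude count suffices (\<open>antipodal_corner\<close>,
\<open>card_edges_two_quadrants\<close>). The formula is wrong for \<open>n = 4\<close>, where degree \<open>12\<close> occurs, so the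
induction starts at \<open>n = 5\<close>, which is settled by exhausting the signed permutations of five
values (\<open>all_bounded_five\<close>).

The bound is attained by the sequence \<open>1, \<dots>, m, -n, \<dots>, -(m + 1)\<close> with \<open>m = \<lfloor>n/2\<rfloor>\<close>
(\<open>extremal_degree\<close>): every pair of entries of opposite sign contributes two reflections, neighbouring
entries of equal sign contribute one each, and the sign change of the first entry contributes one.

On the side of the group, the length is half a weighted number of inversions (\<open>cox_length_eq\<close>), and
the increase caused by a reflection that goes up is a sum of nonnegative contributions of the pairs
of positions that the reflection reverses (\<open>twice_length_comp_signed_swap\<close>, \<open>reversed_cases\<close>).
\<close>

section \<open>Empty boxes in centrally symmetric diagrams\<close>

definition strictly_between :: "int \<Rightarrow> int \<Rightarrow> int \<Rightarrow> bool" where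
  "strictly_between a b c \<longleftrightarrow> a < c \<and> c < b \<or> b < c \<and> c < a"

definition in_box :: "int \<times> int \<Rightarrow> int \<times> int \<Rightarrow> int \<times> int \<Rightarrow> bool" where
  "in_box u v p \<longleftrightarrow> strictly_between (fst u) (fst v) (fst p) \<and> strictly_between (snd u) (snd v) (snd p)"

text \<open>
The plots of signed permutations, with arbitrary distinct coordinates in place of
\<open>\<plusminus>1, \<dots>, \<plusminus>n\<close>: this makes the class closed under deleting a point together with its antipode, so
that no renumbering is needed in the induction.
\<close>

definition diagram :: "(int \<times> int) set \<Rightarrow> bool" where
  "diagram P \<longleftrightarrow> finite P \<and> inj_on fst P \<and> inj_on snd P \<and>
     (\<forall>p\<in>P. - p \<in> P \<and> fst p \<noteq> 0 \<and> snd p \<noteq> 0)"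

text \<open>
The exception for antipodal points reflects that the box of \<open>u\<close> and \<open>-u\<close> always contains the origin.
For other pairs the origin in the box means that the corresponding reflection changes the length by
at least three: sign changes lead to an intermediate element.
\<close>

definition adj :: "(int \<times> int) set \<Rightarrow> int \<times> int \<Rightarrow> int \<times> int \<Rightarrow> bool" where
  "adj P u v \<longleftrightarrow> u \<in> P \<and> v \<in> P \<and> u \<noteq> v \<and> (\<forall>p\<in>P. \<not> in_box u v p) \<and> (v = - u \<or> \<not> in_box u v 0)"

definition nbrs :: "(int \<times> int) set \<Rightarrow> int \<times> int \<Rightarrow> (int \<times> int) set" where
  "nbrs P u = {v. adj P u v}"

text \<open>
The pair \<open>u\<close>, \<open>v\<close> and its antipodal copy belong to the same reflection.
\<close>

definition orb :: "int \<times> int \<Rightarrow> int \<times> int \<Rightarrow> (int \<times> int) set set" where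
  "orb u v = {{u, v}, {- u, - v}}"

definition edges :: "(int \<times> int) set \<Rightarrow> (int \<times> int) set set set" where
  "edges P = {orb u v |u v. adj P u v}"

lemma edgesE:
  assumes "e \<in> edges P"
  obtains u v where "e = orb u v" "adj P u v"
  using assms unfolding edges_def mem_Collect_eq by (elim exE conjE)

lemma edgesI: "adj P u v \<Longrightarrow> orb u v \<in> edges P"
  unfolding edges_def mem_Collect_eq by (intro exI conjI) (rule refl)

lemma strictly_between_commute: "strictly_between a b = strictly_between b a"
  by (auto simp: strictly_between_def fun_eq_iff)

lemma strictly_between_uminus: "strictly_between (- a) (- b) (- c) = strictly_between a b c"
  by (auto simp: strictly_between_def)

lemma in_box_commute: "in_box u v = in_box v u"
  by (simp add: in_box_def strictly_between_commute fun_eq_iff)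

lemma in_box_uminus: "in_box (- u) (- v) (- p) = in_box u v p"
  by (simp add: in_box_def strictly_between_uminus)

lemma in_box_uminus_zero: "in_box (- u) (- v) 0 = in_box u v 0"
  using in_box_uminus[of u v 0] by simp

lemma orb_commute: "orb u v = orb v u"
  by (simp add: orb_def insert_commute)

lemma orb_uminus: "orb (- u) (- v) = orb u v"
  by (simp add: orb_def insert_commute)

lemma diagram_finite: "diagram P \<Longrightarrow> finite P"
  by (simp add: diagram_def)

lemma diagram_uminus: "diagram P \<Longrightarrow> p \<in> P \<Longrightarrow> - p \<in> P"
  by (simp add: diagram_def)

lemma diagram_distinct:
  "diagram P \<Longrightarrow> p \<in> P \<Longrightarrow> q \<in> P \<Longrightarrow> p \<noteq> q \<Longrightarrow> fst p \<noteq> fst q \<and> snd p \<noteq> snd q"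
  by (metis diagram_def inj_onD)

lemma adj_in: "adj P u v \<Longrightarrow> u \<in> P \<and> v \<in> P \<and> u \<noteq> v"
  by (simp add: adj_def)

lemma adj_box: "adj P u v \<Longrightarrow> p \<in> P \<Longrightarrow> \<not> in_box u v p"
  by (simp add: adj_def)

lemma in_nbrs: "v \<in> nbrs P u \<longleftrightarrow> adj P u v"
  by (simp add: nbrs_def)

lemma adj_commute: "adj P u v = adj P v u"
  by (auto simp: adj_def in_box_commute)

lemma adj_uminus:
  assumes "diagram P"
  shows "adj P (- u) (- v) = adj P u v"
proof -
  have imp: "adj P (- u) (- v)" if "adj P u v" for u v
    unfolding adj_def
  proof (intro conjI ballI)
    show "- u \<in> P" "- v \<in> P" "- u \<noteq> - v"
      using that assms by (auto simp: adj_def diagram_def)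
    show "\<not> in_box (- u) (- v) p" if "p \<in> P" for p
    proof -
      have "- p \<in> P" using that assms by (auto simp: diagram_def)
      then have "\<not> in_box u v (- p)" using \<open>adj P u v\<close> by (auto simp: adj_def)
      then show ?thesis using in_box_uminus[of u v "- p"] by simp
    qed
    show "- v = - (- u) \<or> \<not> in_box (- u) (- v) 0"
      using that by (auto simp: adj_def in_box_uminus_zero)
  qed
  show ?thesis using imp[of u v] imp[of "- u" "- v"] unfolding add.inverse_inverse by blast
qed

lemma nbrs_subset: "nbrs P u \<subseteq> P - {u}"
  by (auto simp: nbrs_def adj_def)

lemma nbrs_uminus: "diagram P \<Longrightarrow> nbrs P (- u) = uminus ` nbrs P u"
proof -
  assume P: "diagram P"
  have "adj P (- u) v \<longleftrightarrow> adj P u (- v)" for v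
    using adj_uminus[OF P, of u "- v"] by (simp only: add.inverse_inverse)
  then have "nbrs P (- u) = {v. - v \<in> nbrs P u}" by (simp only: nbrs_def mem_Collect_eq)
  also have "\<dots> = uminus ` nbrs P u"
    by (force simp only: image_iff mem_Collect_eq add.inverse_inverse)
  finally show ?thesis .
qed

lemma finite_nbrs: "diagram P \<Longrightarrow> finite (nbrs P u)"
  using nbrs_subset[of P u] by (auto simp: diagram_def intro: finite_subset)

lemma finite_edges: "diagram P \<Longrightarrow> finite (edges P)"
proof -
  assume "diagram P"
  then have "finite ((\<lambda>(u, v). orb u v) ` (P \<times> P))" by (simp add: diagram_def)
  moreover have "edges P \<subseteq> (\<lambda>(u, v). orb u v) ` (P \<times> P)"
    by (auto simp: edges_def adj_def)
  ultimately show ?thesis by (rule rev_finite_subset)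
qed

lemma uminus_neq: "diagram P \<Longrightarrow> u \<in> P \<Longrightarrow> - u \<noteq> u"
  by (auto simp: diagram_def prod_eq_iff)

lemma diagram_subset:
  assumes "diagram P" "Q \<subseteq> P" "\<And>p. p \<in> Q \<Longrightarrow> - p \<in> Q"
  shows "diagram Q"
  using assms unfolding diagram_def by (meson finite_subset inj_on_subset subsetD)

lemma diagram_delete:
  assumes "diagram P"
  shows "diagram (P - {u, - u})"
proof (rule diagram_subset[OF assms])
  fix p assume p: "p \<in> P - {u, - u}"
  then have "- p \<in> P" using assms by (simp add: diagram_def)
  moreover have "- p \<noteq> u" using p by (metis DiffD2 insertCI minus_minus)
  moreover have "- p \<noteq> - u" using p by simp
  ultimately show "- p \<in> P - {u, - u}" by simp
qed blast

lemma card_delete: "diagram P \<Longrightarrow> u \<in> P \<Longrightarrow> card (P - {u, - u}) = card P - 2"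
  using uminus_neq[of P u] by (subst card_Diff_subset) (auto simp: diagram_def)

lemma adj_mono: "adj P u v \<Longrightarrow> Q \<subseteq> P \<Longrightarrow> u \<in> Q \<Longrightarrow> v \<in> Q \<Longrightarrow> adj Q u v"
  by (auto simp: adj_def)

text \<open>
An edge at \<open>-u\<close> is also an edge at \<open>u\<close>, by passing to the antipodal copy of the pair.
\<close>

lemma orb_at:
  assumes P: "diagram P" and ab: "adj P a b" and u: "a \<in> {u, - u} \<or> b \<in> {u, - u}"
  shows "orb a b \<in> orb u ` nbrs P u"
proof -
  have *: "orb a b \<in> orb u ` nbrs P u" if "adj P a b" "a \<in> {u, - u}" for a b
  proof (cases "a = u")
    case True
    then show ?thesis using that by (auto simp: nbrs_def)
  next
    case False
    then have "a = - u" using that by simp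
    then have "adj P u (- b)" "orb a b = orb u (- b)"
      using that adj_uminus[OF P, of u "- b"] orb_uminus[of u "- b"] by auto
    then show ?thesis by (auto simp: nbrs_def)
  qed
  show ?thesis
    using u *[OF ab] *[of b a] ab unfolding adj_commute[of P b a] orb_commute[of b a] by blast
qed

lemma edges_delete:
  assumes "diagram P" "adj P a b"
  shows "orb a b \<in> edges (P - {u, - u}) \<or> orb a b \<in> orb u ` nbrs P u"
proof (cases "a \<in> {u, - u} \<or> b \<in> {u, - u}")
  case False
  then have "adj (P - {u, - u}) a b"
    using adj_in[OF assms(2)] by (intro adj_mono[OF assms(2)]) blast+
  then show ?thesis by (intro disjI1 edgesI)
next
  case True
  then show ?thesis using orb_at[OF assms] by (rule_tac disjI2)
qed

text \<open>
Fewer points mean fewer obstacles, so all edges that avoid the deleted points survive.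
\<close>

lemma card_edges_delete:
  assumes "diagram P"
  shows "card (edges P) \<le> card (edges (P - {u, - u})) + card (nbrs P u)"
proof -
  have "edges P \<subseteq> edges (P - {u, - u}) \<union> orb u ` nbrs P u"
  proof
    fix e assume "e \<in> edges P"
    then obtain a b where "e = orb a b" "adj P a b" by (rule edgesE)
    then show "e \<in> edges (P - {u, - u}) \<union> orb u ` nbrs P u"
      using edges_delete[OF assms, of a b u] by simp
  qed
  then have "card (edges P) \<le> card (edges (P - {u, - u}) \<union> orb u ` nbrs P u)"
    using assms by (intro card_mono) (auto simp: finite_edges diagram_delete finite_nbrs)
  also have "\<dots> \<le> card (edges (P - {u, - u})) + card (orb u ` nbrs P u)"
    by (rule card_Un_le)
  finally show ?thesis
    using card_image_le[OF finite_nbrs[OF assms], of "orb u" u] by linarith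
qed

text \<open>
Edges that join one of \<open>\<plusminus>u\<close> to one of \<open>\<plusminus>v\<close> are counted at \<open>u\<close>; hence the neighbours \<open>\<plusminus>u\<close> of \<open>v\<close> are
left out in the second term. This saving is what makes the induction step sharp.
\<close>

lemma card_edges_delete2:
  assumes "diagram P"
  shows "card (edges P) \<le> card (edges (P - {u, - u} - {v, - v}))
           + card (nbrs P u) + card (nbrs P v - {u, - u})"
proof -
  let ?Q = "P - {u, - u} - {v, - v}"
  have "edges P \<subseteq> edges ?Q \<union> orb u ` nbrs P u \<union> orb v ` (nbrs P v - {u, - u})"
  proof
    fix e assume "e \<in> edges P"
    then obtain a b where e: "e = orb a b" and ab: "adj P a b" by (rule edgesE)
    show "e \<in> edges ?Q \<union> orb u ` nbrs P u \<union> orb v ` (nbrs P v - {u, - u})"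
    proof (cases "{a, b} \<subseteq> ?Q")
      case True
      then have "adj ?Q a b" by (intro adj_mono[OF ab]) blast+
      then show ?thesis unfolding e by (intro UnI1 edgesI)
    next
      case False
      then have "a \<in> {u, - u} \<or> b \<in> {u, - u} \<or> a \<in> {v, - v} \<or> b \<in> {v, - v}"
        using adj_in[OF ab] by blast
      then consider "e \<in> orb u ` nbrs P u" | "e \<in> orb v ` nbrs P v"
        using orb_at[OF assms ab, of u] orb_at[OF assms ab, of v] unfolding e by argo
      then show ?thesis
      proof cases
        case 2
        then obtain c where c: "e = orb v c" "adj P v c" unfolding nbrs_def by blast
        consider "c = u" | "c = - u" | "c \<notin> {u, - u}" by blast
        then show ?thesis
        proof cases
          case 1
          then have "e = orb u v" "adj P u v"
            using c adj_commute[of P u v] orb_commute[of u v] by simp_all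
          then show ?thesis unfolding nbrs_def by blast
        next
          case 2
          then have "e = orb u (- v)" "adj P u (- v)"
            using c adj_uminus[OF assms, of u "- v"] adj_commute[of P v] orb_commute[of v]
              orb_uminus[of u "- v"] by simp_all
          then show ?thesis unfolding nbrs_def by blast
        next
          case 3
          then show ?thesis using c unfolding nbrs_def by blast
        qed
      qed auto
    qed
  qed
  then have "card (edges P) \<le> card (edges ?Q \<union> orb u ` nbrs P u \<union> orb v ` (nbrs P v - {u, - u}))"
    using assms by (intro card_mono) (auto simp: finite_edges diagram_delete finite_nbrs)
  also have "\<dots> \<le> card (edges ?Q) + card (orb u ` nbrs P u) + card (orb v ` (nbrs P v - {u, - u}))"
    by (meson add_le_mono card_Un_le le_refl order_trans)
  finally have "card (edges P) \<le> card (edges ?Q) + card (orb u ` nbrs P u) + card (orb v ` (nbrs P v - {u, - u}))" .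
  moreover have "card (orb u ` nbrs P u) \<le> card (nbrs P u)"
    using assms by (intro card_image_le finite_nbrs)
  moreover have "card (orb v ` (nbrs P v - {u, - u})) \<le> card (nbrs P v - {u, - u})"
    using assms by (intro card_image_le) (auto simp: finite_nbrs)
  ultimately show ?thesis by linarith
qed

definition leftmost :: "(int \<times> int) set \<Rightarrow> int \<times> int \<Rightarrow> bool" where
  "leftmost P u \<longleftrightarrow> u \<in> P \<and> (\<forall>p\<in>P. fst u \<le> fst p)"

lemma leftmost_exists: "diagram P \<Longrightarrow> P \<noteq> {} \<Longrightarrow> \<exists>u. leftmost P u"
  unfolding leftmost_def diagram_def
  by (metis arg_min_if_finite(1) arg_min_least)

lemma leftmost_strict:
  assumes "diagram P" "leftmost P u" "p \<in> P" "p \<noteq> u"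
  shows "fst u < fst p"
  using assms unfolding leftmost_def diagram_def by (metis inj_onD order_less_le)

lemma leftmost_neg:
  assumes "diagram P" "leftmost P u" "p \<in> P"
  shows "\<bar>fst p\<bar> \<le> - fst u"
proof -
  have "- p \<in> P" using assms by (simp add: diagram_def)
  then have "fst u \<le> fst p" "fst u \<le> fst (- p)" using assms unfolding leftmost_def by blast+
  then show ?thesis by simp
qed

text \<open>
A common neighbour cannot lie to the right of \<open>v\<close>, nor inside the box of \<open>u\<close> and \<open>v\<close>, so it is above
or below that box. Let \<open>c\<close>, \<open>d\<close> be two of them above it, with \<open>c\<close> to the left of \<open>d\<close>. If \<open>c\<close> is lower
than \<open>d\<close> it obstructs \<open>u\<close> and \<open>d\<close>, and otherwise \<open>d\<close> obstructs \<open>c\<close> and \<open>v\<close>. The same holds below.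
\<close>

lemma card_common_nbrs:
  assumes P: "diagram P" and u: "leftmost P u" and uv: "adj P u v"
    and v: "\<forall>p\<in>nbrs P u. fst p \<le> fst v"
  shows "card (nbrs P u \<inter> nbrs P v) \<le> 2"
proof -
  let ?C = "nbrs P u \<inter> nbrs P v"
  let ?A = "{c \<in> ?C. snd u < snd c \<and> snd v < snd c}"
  let ?B = "{c \<in> ?C. snd c < snd u \<and> snd c < snd v}"
  have x: "fst u < fst c \<and> fst c < fst v \<and> snd c \<noteq> snd u \<and> snd c \<noteq> snd v" if "c \<in> ?C" for c
  proof -
    have "adj P u c" "adj P v c" "fst c \<le> fst v" using that v unfolding in_nbrs[symmetric] by blast+
    then have c: "c \<in> P" "c \<noteq> u" "c \<noteq> v" "u \<in> P" "v \<in> P" "fst c \<le> fst v"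
      using adj_in[of P u c] adj_in[of P v c] by blast+
    then have "fst c \<noteq> fst v" "snd c \<noteq> snd u" "snd c \<noteq> snd v"
      using diagram_distinct[OF P] by blast+
    with c leftmost_strict[OF P u, of c] show ?thesis by auto
  qed
  have fin: "finite ?C" using P by (simp add: finite_nbrs)
  have box: "\<not> in_box u v c" "\<not> in_box u c d" "\<not> in_box c v d"
    if "c \<in> ?C" "d \<in> ?C" for c d
  proof -
    have *: "adj P u c" "adj P c v" "adj P u d" "c \<in> P" "d \<in> P"
      using that adj_commute[of P v c] adj_in[of P u] unfolding in_nbrs Int_iff by simp_all
    show "\<not> in_box u v c" "\<not> in_box u c d" "\<not> in_box c v d"
      using * uv adj_box by blast+
  qed
  \<comment> \<open>Since \<open>c\<close> is horizontally between \<open>u\<close> and \<open>v\<close>, it can avoid their box only vertically.\<close>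
  have "?C \<subseteq> ?A \<union> ?B"
  proof
    fix c assume c: "c \<in> ?C"
    then have "snd c \<noteq> snd u" "snd c \<noteq> snd v" using x by auto
    then show "c \<in> ?A \<union> ?B"
      using c x[OF c] box(1)[OF c c] by (auto simp: in_box_def strictly_between_def)
  qed
  moreover have "card ?A \<le> Suc 0"
  proof (subst card_le_Suc0_iff_eq)
    show "\<forall>c\<in>?A. \<forall>d\<in>?A. c = d"
    proof (intro ballI, rule ccontr)
      fix c d assume *: "c \<in> ?A" "d \<in> ?A" "c \<noteq> d"
      then have "c \<in> P" "d \<in> P" using nbrs_subset[of P u] by blast+
      then have "fst c \<noteq> fst d" "snd c \<noteq> snd d"
        using diagram_distinct[OF P] \<open>c \<noteq> d\<close> by blast+
      with * x[of c] x[of d] box(2,3)[of c d] box(2,3)[of d c]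
      show False by (auto simp: in_box_def strictly_between_def)
    qed
  qed (rule finite_subset[OF _ fin], blast)
  moreover have "card ?B \<le> Suc 0"
  proof (subst card_le_Suc0_iff_eq)
    show "\<forall>c\<in>?B. \<forall>d\<in>?B. c = d"
    proof (intro ballI, rule ccontr)
      fix c d assume *: "c \<in> ?B" "d \<in> ?B" "c \<noteq> d"
      then have "c \<in> P" "d \<in> P" using nbrs_subset[of P u] by blast+
      then have "fst c \<noteq> fst d" "snd c \<noteq> snd d"
        using diagram_distinct[OF P] \<open>c \<noteq> d\<close> by blast+
      with * x[of c] x[of d] box(2,3)[of c d] box(2,3)[of d c]
      show False by (auto simp: in_box_def strictly_between_def)
    qed
  qed (rule finite_subset[OF _ fin], blast)
  moreover have "finite (?A \<union> ?B)" by (rule finite_subset[OF _ fin]) blast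
  ultimately show ?thesis
    using card_mono[of "?A \<union> ?B" ?C] card_Un_le[of ?A ?B] by linarith
qed

text \<open>
The second point from the left is a neighbour: the box is too narrow for further points, and it
can reach across the vertical axis only if the two points are antipodal.
\<close>

lemma leftmost_nbrs_nonempty:
  assumes P: "diagram P" and u: "leftmost P u"
  shows "nbrs P u \<noteq> {}"
proof -
  have uP: "u \<in> P" "- u \<in> P" "- u \<noteq> u"
    using u uminus_neq[OF P, of u] diagram_uminus[OF P, of u] by (simp_all add: leftmost_def)
  then obtain p where p: "p \<in> P - {u}" and least: "\<And>q. q \<in> P - {u} \<Longrightarrow> fst p \<le> fst q"
    using P by (metis (no_types, opaque_lifting) Diff_iff arg_min_if_finite(1) arg_min_least diagram_def
        empty_iff finite_Diff insertE)
  have "adj P u p"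
    unfolding adj_def
  proof (intro conjI ballI)
    show "u \<in> P" "p \<in> P" "u \<noteq> p" using p uP by auto
    show "\<not> in_box u p q" if "q \<in> P" for q
      using that least[of q] leftmost_strict[OF P u, of p] p
      by (cases "q = u") (auto simp: in_box_def strictly_between_def)
    show "p = - u \<or> \<not> in_box u p 0"
    proof (cases "- p = u")
      case False
      have "- p \<in> P" using p diagram_uminus[OF P] by blast
      then have "fst p \<le> fst (- p)" using False least by blast
      then show ?thesis using p leftmost_strict[OF P u, of p] by (auto simp: in_box_def strictly_between_def)
    qed auto
  qed
  then have "p \<in> nbrs P u" by (simp add: nbrs_def)
  then show ?thesis by blast
qed

lemma card_add_nbrs:
  assumes "diagram P"
  shows "card (nbrs P u) + card (nbrs P v) = card (nbrs P u \<union> nbrs P v) + card (nbrs P u \<inter> nbrs P v)"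
  using assms by (intro card_Un_Int finite_nbrs)

lemma card_nbrs_uminus: "diagram P \<Longrightarrow> card (nbrs P (- u)) = card (nbrs P u)"
  by (simp add: nbrs_uminus card_image)

text \<open>
The antipode of the leftmost point is the rightmost point, so it is the rightmost neighbour as soon as
it is a neighbour at all. Both points have the same degree, by symmetry. The set \<open>Q\<close> may leave out
points that are known not to be neighbours.
\<close>

lemma leftmost_antipodal:
  assumes P: "diagram P" and u: "leftmost P u" and adj: "adj P u (- u)" and Q: "nbrs P u \<subseteq> Q" "uminus ` Q \<subseteq> Q" "Q \<subseteq> P"
  shows "2 * card (nbrs P u) \<le> card Q + 2"
proof -
  have "card (nbrs P u \<inter> nbrs P (- u)) \<le> 2"
  proof (rule card_common_nbrs[OF P u adj])
    show "\<forall>p\<in>nbrs P u. fst p \<le> fst (- u)"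
    proof
      fix p assume "p \<in> nbrs P u"
      then have "\<bar>fst p\<bar> \<le> - fst u" using leftmost_neg[OF P u] nbrs_subset by blast
      then show "fst p \<le> fst (- u)" by simp
    qed
  qed
  moreover have "card (nbrs P u \<union> nbrs P (- u)) \<le> card Q"
  proof (rule card_mono)
    show "finite Q" using Q(3) diagram_finite[OF P] by (rule finite_subset)
    show "nbrs P u \<union> nbrs P (- u) \<subseteq> Q"
      using Q(1,2) unfolding nbrs_uminus[OF P] by blast
  qed
  ultimately show ?thesis using card_add_nbrs[OF P, of u "- u"] card_nbrs_uminus[OF P, of u] by linarith
qed

text \<open>
The sum of the degrees of \<open>u\<close> and \<open>v\<close> is the size of the union plus the size of the intersection of
their neighbourhoods, at most \<open>card P + 2\<close>. If \<open>u\<close> is also adjacent to \<open>-v\<close>, two edges are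
counted twice. If not, then only one is, but \<open>-u\<close> is missing from the union.
\<close>

lemma leftmost_pair:
  assumes P: "diagram P" and u: "leftmost P u" and nadj: "\<not> adj P u (- u)"
  obtains v where "v \<in> P" "v \<noteq> u" "v \<noteq> - u"
    "card (edges P) \<le> card (edges (P - {u, - u} - {v, - v})) + card P"
    "card (nbrs P u) + card (nbrs P v) \<le> card P + 2"
proof -
  have fin_u: "finite (fst ` nbrs P u)" using finite_nbrs[OF P] by simp
  then have "Max (fst ` nbrs P u) \<in> fst ` nbrs P u"
    using leftmost_nbrs_nonempty[OF P u] by (intro Max_in) simp_all
  then obtain v where v_in: "v \<in> nbrs P u" and "fst v = Max (fst ` nbrs P u)" by force
  then have v: "\<forall>p\<in>nbrs P u. fst p \<le> fst v" using fin_u by simp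
  from v_in have uv: "adj P u v" by (simp add: nbrs_def)
  have vu: "v \<noteq> u" "v \<noteq> - u" "v \<in> P" "u \<in> P" using uv nadj adj_in[OF uv] by blast+
  have finP: "finite P" using P by (simp add: diagram_def)
  have common: "card (nbrs P u \<inter> nbrs P v) \<le> 2" by (rule card_common_nbrs[OF P u uv v])
  have union: "card (nbrs P u \<union> nbrs P v) \<le> card P"
    using finP nbrs_subset by (intro card_mono) blast+
  have deg: "card (nbrs P u) + card (nbrs P v) \<le> card P + 2"
    using card_add_nbrs[OF P, of u v] common union by linarith
  have uv': "u \<in> nbrs P v" using uv unfolding in_nbrs adj_commute[of P v u] .
  have fin: "finite (nbrs P v)" by (rule finite_nbrs[OF P])
  \<comment> \<open>\<open>-u\<close> is adjacent to \<open>v\<close> iff \<open>u\<close> is adjacent to \<open>-v\<close>.\<close>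
  have "card (nbrs P u) + card (nbrs P v - {u, - u}) \<le> card P"
  proof (cases "- u \<in> nbrs P v")
    case True
    then have sub: "{u, - u} \<subseteq> nbrs P v" using uv' by blast
    have two: "card {u, - u} = 2" using uminus_neq[OF P vu(4)] by simp
    have "card (nbrs P v - {u, - u}) = card (nbrs P v) - card {u, - u}"
      using sub by (intro card_Diff_subset) simp_all
    moreover have "card {u, - u} \<le> card (nbrs P v)" using sub fin by (intro card_mono)
    ultimately show ?thesis using deg two by linarith
  next
    case False
    have "nbrs P u \<union> nbrs P v \<subseteq> P - {- u}"
      using nbrs_subset[of P] False nadj in_nbrs by blast
    then have "card (nbrs P u \<union> nbrs P v) \<le> card (P - {- u})"
      using finP by (intro card_mono) auto
    also have "\<dots> = card P - 1" using diagram_uminus[OF P vu(4)] finP by simp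
    finally have "card (nbrs P u \<union> nbrs P v) \<le> card P - 1" .
    moreover have "card P > 0" using vu finP card_gt_0_iff by blast
    ultimately have "card (nbrs P u) + card (nbrs P v) \<le> card P + 1"
      using card_add_nbrs[OF P, of u v] common by linarith
    moreover have "nbrs P v - {u, - u} = nbrs P v - {u}" using False by blast
    then have "Suc (card (nbrs P v - {u, - u})) = card (nbrs P v)"
      using uv' fin by (metis card_Suc_Diff1)
    ultimately show ?thesis by linarith
  qed
  then have "card (edges P) \<le> card (edges (P - {u, - u} - {v, - v})) + card P"
    using card_edges_delete2[OF P, of u v] by linarith
  with that vu deg show ?thesis by blast
qed

text \<open>
If the leftmost point is adjacent to its antipode this is \<open>leftmost_antipodal\<close>; otherwise one of the
two points of \<open>leftmost_pair\<close> will do.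
\<close>

lemma small_degree:
  assumes P: "diagram P" "card P = 2 * n" "n > 0"
  obtains k where "k \<in> P" "card (nbrs P k) \<le> n + 1"
proof -
  have "P \<noteq> {}" using P by auto
  then obtain u where u: "leftmost P u" using leftmost_exists P by blast
  then have uP: "u \<in> P" by (simp add: leftmost_def)
  show ?thesis
  proof (cases "adj P u (- u)")
    case True
    have "2 * card (nbrs P u) \<le> card P + 2"
      proof (rule leftmost_antipodal[OF P(1) u True])
      show "nbrs P u \<subseteq> P" "uminus ` P \<subseteq> P" "P \<subseteq> P"
        using nbrs_subset[of P u] P(1) unfolding diagram_def by blast+
    qed
    then show ?thesis using that uP P by auto
  next
    case False
    then obtain v where "v \<in> P" "card (nbrs P u) + card (nbrs P v) \<le> card P + 2"
      by (rule leftmost_pair[OF P(1) u])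
    then show ?thesis using that[of u] that[of v] uP P by linarith
  qed
qed

section \<open>Exchanging the two coordinates\<close>

lemma swap_uminus: "prod.swap (- p) = - prod.swap (p :: int \<times> int)"
  by (simp add: prod_eq_iff)

lemma in_box_swap: "in_box (prod.swap u) (prod.swap v) (prod.swap p) = in_box u v p"
  by (auto simp: in_box_def)

lemma diagram_swap:
  assumes "diagram P"
  shows "diagram (prod.swap ` P)"
proof -
  have "inj_on fst (prod.swap ` P)" "inj_on snd (prod.swap ` P)"
    using assms by (auto simp: diagram_def intro!: inj_on_imageI simp: comp_def)
  then show ?thesis
    using assms by (simp add: diagram_def swap_uminus[symmetric])
qed

lemma adj_swap: "adj (prod.swap ` P) (prod.swap u) (prod.swap v) = adj P u v"
proof -
  have "in_box (prod.swap u) (prod.swap v) 0 = in_box u v 0"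
    by (auto simp: in_box_def)
  moreover have "prod.swap x \<in> prod.swap ` P \<longleftrightarrow> x \<in> P" for x
    by (simp add: inj_image_mem_iff)
  ultimately show ?thesis
    unfolding adj_def by (simp add: in_box_swap swap_uminus[symmetric] inj_eq)
qed

lemma nbrs_swap: "nbrs (prod.swap ` P) (prod.swap u) = prod.swap ` nbrs P u"
proof -
  have "v \<in> nbrs (prod.swap ` P) (prod.swap u) \<longleftrightarrow> prod.swap v \<in> nbrs P u" for v
    using adj_swap[of P u "prod.swap v"] by (simp add: in_nbrs)
  then have "nbrs (prod.swap ` P) (prod.swap u) = {v. prod.swap v \<in> nbrs P u}" by blast
  also have "\<dots> = prod.swap ` nbrs P u"
    by (force simp only: image_iff mem_Collect_eq swap_swap)
  finally show ?thesis .
qed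

lemma card_nbrs_swap: "card (nbrs (prod.swap ` P) (prod.swap u)) = card (nbrs P u)"
  unfolding nbrs_swap by (intro card_image) simp

text \<open>
Exchanging coordinates corresponds to inverting the signed permutation. It turns statements about
the leftmost point into statements about the lowest one.
\<close>

lemma card_edges_swap:
  assumes "diagram P"
  shows "card (edges (prod.swap ` P)) = card (edges P)"
proof -
  have le: "card (edges (prod.swap ` P)) \<le> card (edges P)" if P: "diagram P" for P
  proof -
    have "edges (prod.swap ` P) \<subseteq> (`) ((`) prod.swap) ` edges P"
    proof
      fix e assume "e \<in> edges (prod.swap ` P)"
      then obtain u v where e: "e = orb u v" and uv: "adj (prod.swap ` P) u v" by (rule edgesE)
      then have "adj P (prod.swap u) (prod.swap v)"
        using adj_swap[of P "prod.swap u" "prod.swap v"] by simp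
      moreover have "e = (`) prod.swap ` orb (prod.swap u) (prod.swap v)"
        unfolding e orb_def by (simp add: swap_uminus)
      ultimately show "e \<in> (`) ((`) prod.swap) ` edges P" using edgesI by blast
    qed
    then have "card (edges (prod.swap ` P)) \<le> card ((`) ((`) prod.swap) ` edges P)"
      using finite_edges[OF P] by (intro card_mono) simp_all
    also have "\<dots> \<le> card (edges P)" by (intro card_image_le finite_edges[OF P])
    finally show ?thesis .
  qed
  have "prod.swap ` prod.swap ` P = P" by (simp add: image_image)
  then show ?thesis using le[OF assms] le[OF diagram_swap[OF assms]] by simp
qed

lemma swap_delete:
  "prod.swap ` (P - {u, - u}) = prod.swap ` P - {prod.swap u, - prod.swap (u :: int \<times> int)}"
  by (simp add: image_set_diff swap_uminus)

text \<open>
A point with a smaller absolute value of its second coordinate would lie in the box of \<open>u\<close> and \<open>-u\<close>,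
which has the full width of the diagram.
\<close>

lemma leftmost_antipodal_abs:
  assumes P: "diagram P" and u: "leftmost P u" and adj: "adj P u (- u)"
    and p: "p \<in> P - {u, - u}"
  shows "\<bar>snd u\<bar> < \<bar>snd p\<bar>" "\<bar>fst p\<bar> < - fst u"
proof -
  have in_P: "u \<in> P" "- u \<in> P" "p \<in> P" "- p \<in> P" "p \<noteq> u" "p \<noteq> - u"
    using p adj_in[OF adj] diagram_uminus[OF P] by blast+
  then have "fst u < fst p" "\<bar>fst p\<bar> \<le> - fst u" "fst p \<noteq> fst (- u)"
    using leftmost_strict[OF P u] leftmost_neg[OF P u] diagram_distinct[OF P, of p "- u"] by blast+
  then show "\<bar>fst p\<bar> < - fst u" by auto
  have "snd p \<noteq> snd u" "snd p \<noteq> snd (- u)"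
    using in_P diagram_distinct[OF P, of p] by blast+
  moreover have "\<not> in_box u (- u) p" using adj in_P by (intro adj_box)
  ultimately show "\<bar>snd u\<bar> < \<bar>snd p\<bar>"
    using \<open>\<bar>fst p\<bar> < - fst u\<close> by (auto simp: in_box_def strictly_between_def)
qed

lemma card_half:
  assumes P: "diagram P" and "card P = 2 * m"
  shows "card {p \<in> P. fst p < 0} = m" "card {p \<in> P. 0 < fst p} = m"
proof -
  let ?N = "{p \<in> P. fst p < 0}" and ?Q = "{p \<in> P. 0 < fst p}"
  have "fst p \<noteq> 0" if "p \<in> P" for p using that P by (simp add: diagram_def)
  then have "P = ?N \<union> ?Q" by force
  moreover have "card (?N \<union> ?Q) = card ?N + card ?Q"
    using diagram_finite[OF P] by (intro card_Un_disjoint) auto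
  moreover have "bij_betw uminus ?N ?Q"
  proof (rule bij_betw_byWitness[where f' = uminus])
    show "uminus ` ?N \<subseteq> ?Q" "uminus ` ?Q \<subseteq> ?N"
      using diagram_uminus[OF P] by force+
  qed simp_all
  then have "card ?N = card ?Q" by (rule bij_betw_same_card)
  ultimately show "card ?N = m" "card ?Q = m"
    using assms(2) by simp_all
qed

text \<open>
If the origin separates the left half from the right half, then a point of the left half has at most
the other points of that half and its own antipode as neighbours, and the bound is the sum of
\<open>m, m - 1, \<dots>, 1\<close>.
\<close>

lemma card_edges_two_quadrants:
  assumes "diagram P" "card P = 2 * m"
    and "\<And>p q. \<lbrakk>p \<in> P; q \<in> P; fst p < 0; 0 < fst q; q \<noteq> - p\<rbrakk> \<Longrightarrow> in_box p q 0"
  shows "2 * card (edges P) \<le> m * (m + 1)"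
  using assms
proof (induction m arbitrary: P)
  case 0
  then have "P = {}" by (simp add: diagram_def)
  then show ?case by (simp add: edges_def adj_def)
next
  case (Suc m)
  let ?N = "{p \<in> P. fst p < 0}"
  have N: "card ?N = Suc m" using card_half(1)[OF Suc.prems(1,2)] .
  then obtain u where u: "u \<in> ?N" by (metis card.empty ex_in_conv nat.distinct(1))
  have fin: "finite ?N" using diagram_finite[OF Suc.prems(1)] by simp
  have "nbrs P u \<subseteq> insert (- u) (?N - {u})"
  proof
    fix v assume "v \<in> nbrs P u"
    then have v: "adj P u v" unfolding in_nbrs .
    then have "v \<in> P" "v \<noteq> u" "fst v \<noteq> 0"
      using adj_in[OF v] Suc.prems(1) by (auto simp: diagram_def)
    moreover have "0 < fst v \<Longrightarrow> v = - u"
      using v u \<open>v \<in> P\<close> Suc.prems(3)[of u v] by (auto simp: adj_def)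
    ultimately show "v \<in> insert (- u) (?N - {u})" by auto
  qed
  then have "card (nbrs P u) \<le> card (insert (- u) (?N - {u}))"
    using fin by (intro card_mono) simp_all
  also have "\<dots> \<le> Suc (card (?N - {u}))" by (rule card_insert_le_m1) simp_all
  also have "\<dots> = Suc m" using N u fin by (simp add: card_Diff_singleton)
  finally have "card (nbrs P u) \<le> Suc m" .
  moreover have "2 * card (edges (P - {u, - u})) \<le> m * (m + 1)"
  proof (rule Suc.IH)
    show "card (P - {u, - u}) = 2 * m"
      using card_delete[OF Suc.prems(1), of u] u Suc.prems(2) by simp
  qed (use Suc.prems diagram_delete in blast)+
  ultimately show ?case
    using card_edges_delete[OF Suc.prems(1), of u] by (simp add: algebra_simps)
qed

section \<open>Deleting two pairs of antipodal points\<close>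

lemma lowest_antipodal:
  assumes P: "diagram P" and s: "leftmost (prod.swap ` P) (prod.swap s)" and adj: "adj P s (- s)"
    and Q: "nbrs P s \<subseteq> Q" "uminus ` Q \<subseteq> Q" "Q \<subseteq> P"
  shows "2 * card (nbrs P s) \<le> card Q + 2"
proof -
  have "2 * card (nbrs (prod.swap ` P) (prod.swap s)) \<le> card (prod.swap ` Q) + 2"
  proof (rule leftmost_antipodal[OF diagram_swap[OF P] s])
    show "adj (prod.swap ` P) (prod.swap s) (- prod.swap s)"
      using adj adj_swap[of P s "- s"] by (simp add: swap_uminus)
    have "uminus ` prod.swap ` Q = prod.swap ` uminus ` Q"
      unfolding image_image swap_uminus ..
    then show "uminus ` prod.swap ` Q \<subseteq> prod.swap ` Q" using image_mono[OF Q(2)] by simp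
    show "nbrs (prod.swap ` P) (prod.swap s) \<subseteq> prod.swap ` Q" "prod.swap ` Q \<subseteq> prod.swap ` P"
      unfolding nbrs_swap using image_mono[OF Q(1)] image_mono[OF Q(3)] .
  qed
  then show ?thesis by (simp add: card_nbrs_swap card_image)
qed

lemma lowest_antipodal_abs:
  assumes P: "diagram P" and s: "leftmost (prod.swap ` P) (prod.swap s)" and adj: "adj P s (- s)"
    and p: "p \<in> P - {s, - s}"
  shows "\<bar>fst s\<bar> < \<bar>fst p\<bar>" "\<bar>snd p\<bar> < - snd s"
proof -
  have "adj (prod.swap ` P) (prod.swap s) (- prod.swap s)"
    using adj adj_swap[of P s "- s"] by (simp add: swap_uminus)
  moreover have "prod.swap p \<in> prod.swap ` P - {prod.swap s, - prod.swap s}"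
    using p unfolding swap_delete[symmetric] by (rule imageI)
  ultimately show "\<bar>fst s\<bar> < \<bar>fst p\<bar>" "\<bar>snd p\<bar> < - snd s"
    using leftmost_antipodal_abs[OF diagram_swap[OF P] s, of "prod.swap p"] by simp_all
qed

text \<open>
If \<open>u\<close> is adjacent neither to \<open>s\<close> nor to \<open>-s\<close>, both degrees drop to at most \<open>n\<close>. Otherwise let \<open>t\<close>
be the one of \<open>\<plusminus>s\<close> adjacent to \<open>u\<close>. Horizontally, the box of \<open>u\<close> and \<open>t\<close> covers all remaining points
to the left of the vertical axis; vertically, it reaches from the smallest to the largest absolute
value. As it is empty, all these points lie on the side of the horizontal axis opposite to \<open>t\<close>,
and so the diagram without \<open>\<plusminus>u\<close>, \<open>\<plusminus>s\<close> lives in two opposite quadrants.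
\<close>

lemma antipodal_corner:
  assumes P: "diagram P" "card P = 2 * n"
    and u: "leftmost P u" "adj P u (- u)"
    and s: "leftmost (prod.swap ` P) (prod.swap s)" "adj P s (- s)" and su: "s \<notin> {u, - u}"
  shows "card (edges P) \<le> card (edges (P - {u, - u} - {s, - s})) + 2 * n \<or>
    card (edges P) \<le> card (edges (P - {u, - u} - {s, - s})) + 2 * n + 1 \<and>
    (\<forall>p\<in>P - {u, - u} - {s, - s}. \<forall>q\<in>P - {u, - u} - {s, - s}. fst p < 0 \<longrightarrow> 0 < fst q \<longrightarrow> in_box p q 0)"
proof -
  have mem: "u \<in> P" "- u \<in> P" "s \<in> P" "- s \<in> P"
    using adj_in[OF u(2)] adj_in[OF s(2)] by blast+
  have neg: "uminus ` (P - {x, - x}) \<subseteq> P - {x, - x}" for x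
    by (intro image_subsetI diagram_uminus diagram_delete P(1))
  have negP: "uminus ` P \<subseteq> P" using diagram_uminus[OF P(1)] by blast
  have su_adj: "adj P s u \<longleftrightarrow> adj P u s" "adj P s (- u) \<longleftrightarrow> adj P u (- s)"
    using adj_commute[of P s] adj_uminus[OF P(1), of u "- s"] unfolding add.inverse_inverse
    by iprover+
  show ?thesis
  proof (cases "s \<in> nbrs P u \<or> - s \<in> nbrs P u")
    case False
    then have "nbrs P u \<subseteq> P - {s, - s}" using nbrs_subset[of P u] by blast
    then have 1: "2 * card (nbrs P u) \<le> card (P - {s, - s}) + 2"
      using leftmost_antipodal[OF P(1) u, of "P - {s, - s}"] neg by blast
    have "nbrs P s \<subseteq> P - {u, - u}"
      using False nbrs_subset[of P s] su_adj[folded in_nbrs] by blast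
    then have 2: "2 * card (nbrs P s) \<le> card (P - {u, - u}) + 2"
      using lowest_antipodal[OF P(1) s, of "P - {u, - u}"] neg by blast
    have "card (nbrs P s - {u, - u}) \<le> card (nbrs P s)"
      by (intro card_mono finite_nbrs P Diff_subset)
    moreover have "card P \<ge> 2"
      using card_mono[of P "{u, - u}"] diagram_finite[OF P(1)] uminus_neq[OF P(1) mem(1)] mem by simp
    ultimately show ?thesis
      using 1 2 card_delete[OF P(1) mem(1)] card_delete[OF P(1) mem(3)] P(2)
        card_edges_delete2[OF P(1), of u s] by linarith
  next
    case True
    then obtain t where t: "t = s \<or> t = - s" "adj P u t" using in_nbrs by blast
    have 1: "2 * card (nbrs P u) \<le> card P + 2"
      using leftmost_antipodal[OF P(1) u, of P] negP nbrs_subset by blast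
    have 2: "2 * card (nbrs P s) \<le> card P + 2"
      using lowest_antipodal[OF P(1) s, of P] negP nbrs_subset by blast
    have "u \<in> nbrs P s \<or> - u \<in> nbrs P s"
      using t su_adj[folded in_nbrs] in_nbrs[of t P u] by blast
    then have "card (nbrs P s - {u, - u}) < card (nbrs P s)"
      by (intro psubset_card_mono finite_nbrs P) blast
    then have le: "card (edges P) \<le> card (edges (P - {u, - u} - {s, - s})) + 2 * n + 1"
      using 1 2 P(2) card_edges_delete2[OF P(1), of u s] by linarith
    \<comment> \<open>Remaining points left of the vertical axis are separated from \<open>t\<close> by the horizontal axis.\<close>
    have sgn: "snd p * snd t < 0" if p: "p \<in> P - {u, - u} - {s, - s}" "fst p < 0" for p
    proof -
      have "\<bar>snd u\<bar> < \<bar>snd p\<bar>" "\<bar>fst p\<bar> < - fst u" "\<bar>fst s\<bar> < \<bar>fst p\<bar>" "\<bar>snd p\<bar> < - snd s"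
        using leftmost_antipodal_abs[OF P(1) u, of p] lowest_antipodal_abs[OF P(1) s, of p] p by blast+
      moreover have "\<not> in_box u t p" using t(2) p by (intro adj_box) blast+
      ultimately show ?thesis
        using t(1) p(2) by (auto simp: in_box_def strictly_between_def mult_less_0_iff)
    qed
    have "in_box p q 0"
      if pq: "p \<in> P - {u, - u} - {s, - s}" "q \<in> P - {u, - u} - {s, - s}" "fst p < 0" "0 < fst q" for p q
    proof -
      have "- q \<in> P - {u, - u} - {s, - s}"
        using pq(2) by (intro diagram_uminus diagram_delete P(1))
      then have "snd p * snd t < 0" "snd (- q) * snd t < 0"
        using sgn[of p] sgn[of "- q"] pq by simp_all
      then show ?thesis
        using pq by (auto simp: in_box_def strictly_between_def mult_less_0_iff zero_less_mult_iff)
    qed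
    then show ?thesis by (intro disjI2 conjI le ballI impI)
  qed
qed

text \<open>
Both the leftmost and the lowest point may serve as the point \<open>u\<close> of \<open>leftmost_pair\<close>. If neither of them
does, \<open>antipodal_corner\<close> applies; its second alternative is where the quadratic lower bound on \<open>B\<close>
comes from.
\<close>

lemma odd_step:
  assumes P: "diagram P" "card P = 2 * n" "n \<ge> 7"
    and IH: "\<And>Q. diagram Q \<Longrightarrow> card Q = 2 * (n - 2) \<Longrightarrow> card (edges Q) + 2 * n \<le> B"
    and B: "(n - 2) * (n - 1) + 4 * n + 2 \<le> 2 * B"
  shows "card (edges P) \<le> B"
proof -
  have good: "card (edges P) \<le> B"
    if "u \<in> P" "v \<in> P" "v \<noteq> u" "v \<noteq> - u"
      "card (edges P) \<le> card (edges (P - {u, - u} - {v, - v})) + 2 * n" for u v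
  proof -
    have "v \<in> P - {u, - u}" using that by blast
    then have "card (P - {u, - u} - {v, - v}) = 2 * (n - 2)"
      using card_delete[OF P(1) that(1)] card_delete[OF diagram_delete[OF P(1)], of v u] P(2) by simp
    moreover have "diagram (P - {u, - u} - {v, - v})" by (intro diagram_delete P(1))
    ultimately show ?thesis using IH[of "P - {u, - u} - {v, - v}"] that(5) by linarith
  qed
  have "P \<noteq> {}" using P by auto
  then obtain u where u: "leftmost P u" using leftmost_exists P by blast
  then have uP: "u \<in> P" by (simp add: leftmost_def)
  have "prod.swap ` P \<noteq> {}" using \<open>P \<noteq> {}\<close> by blast
  then obtain s' where "leftmost (prod.swap ` P) s'" using leftmost_exists[OF diagram_swap[OF P(1)]] by blast
  then obtain s where s: "leftmost (prod.swap ` P) (prod.swap s)" by (metis swap_swap)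
  then have sP: "s \<in> P" by (simp add: leftmost_def inj_image_mem_iff)
  consider "\<not> adj P u (- u)" | "\<not> adj P s (- s)" | "adj P u (- u)" "adj P s (- s)" by blast
  then show ?thesis
  proof cases
    case 1
    then obtain v where "v \<in> P" "v \<noteq> u" "v \<noteq> - u"
      "card (edges P) \<le> card (edges (P - {u, - u} - {v, - v})) + card P"
      by (rule leftmost_pair[OF P(1) u])
    then show ?thesis using good[of u v] uP P(2) by simp
  next
    case 2
    then have "\<not> adj (prod.swap ` P) (prod.swap s) (- prod.swap s)"
      using adj_swap[of P s "- s"] by (simp add: swap_uminus)
    then obtain v' where v': "v' \<in> prod.swap ` P" "v' \<noteq> prod.swap s" "v' \<noteq> - prod.swap s"
      "card (edges (prod.swap ` P)) \<le> card (edges (prod.swap ` P - {prod.swap s, - prod.swap s} - {v', - v'})) + card (prod.swap ` P)"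
      by (rule leftmost_pair[OF diagram_swap[OF P(1)] s])
    define v where "v = prod.swap v'"
    have v'_eq: "v' = prod.swap v" by (simp add: v_def)
    have "prod.swap ` P - {prod.swap s, - prod.swap s} - {v', - v'} = prod.swap ` (P - {s, - s} - {v, - v})"
      unfolding v'_eq swap_delete ..
    then have "card (edges P) \<le> card (edges (P - {s, - s} - {v, - v})) + 2 * n"
      using v'(4) card_edges_swap[OF P(1)] card_edges_swap[OF diagram_delete[OF diagram_delete[OF P(1)]], of s v]
        card_image[OF inj_swap, of P] P(2) by simp
    moreover have "v \<in> P" "v \<noteq> s" "v \<noteq> - s"
      using v'(1-3) unfolding v'_eq by (simp_all add: inj_image_mem_iff) (use swap_uminus in blast)+
    ultimately show ?thesis using good[of s v] sP by simp
  next
    case 3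
    have "card (P - {u, - u}) > 0" using card_delete[OF P(1) uP] P by simp
    then obtain p where p: "p \<in> P - {u, - u}" by (metis card_gt_0_iff ex_in_conv)
    \<comment> \<open>The second coordinate is smallest in absolute value at \<open>u\<close> and largest at \<open>s\<close>.\<close>
    have su: "s \<notin> {u, - u}"
    proof
      assume "s \<in> {u, - u}"
      then have "p \<in> P - {s, - s}" "\<bar>snd s\<bar> = \<bar>snd u\<bar>" using p by auto
      then show False
        using leftmost_antipodal_abs(1)[OF P(1) u 3(1) p] lowest_antipodal_abs(2)[OF P(1) s 3(2), of p] by linarith
    qed
    let ?Q = "P - {u, - u} - {s, - s}"
    from antipodal_corner[OF P(1,2) u 3(1) s 3(2) su] show ?thesis
    proof
      assume "card (edges P) \<le> card (edges ?Q) + 2 * n"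
      then show ?thesis using good[of u s] uP sP su by blast
    next
      assume *: "card (edges P) \<le> card (edges ?Q) + 2 * n + 1 \<and>
        (\<forall>p\<in>?Q. \<forall>q\<in>?Q. fst p < 0 \<longrightarrow> 0 < fst q \<longrightarrow> in_box p q 0)"
      have "s \<in> P - {u, - u}" using sP su by blast
      then have "card ?Q = 2 * (n - 2)"
        using card_delete[OF P(1) uP] card_delete[OF diagram_delete[OF P(1)], of s u] P(2) by simp
      then have "2 * card (edges ?Q) \<le> (n - 2) * (n - 2 + 1)"
        using * diagram_delete P(1) by (intro card_edges_two_quadrants) blast+
      also have "n - 2 + 1 = n - 1" using P(3) by simp
      finally show ?thesis using * B by linarith
    qed
  qed
qed

section \<open>Diagrams with ten points\<close>

text \<open>
The list holds heights of obstacles in the order in which they are met when walking inward from a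
point of height \<open>y\<close>; the result is the number of those that are not hidden by earlier ones. The entry
\<open>0\<close> stands for the origin, which hides others but is not a neighbour itself.
\<close>

fun visible :: "int \<Rightarrow> int list \<Rightarrow> nat" where
  "visible y [] = 0"
| "visible y (z # zs) =
     (if z = 0 then 0 else 1) + visible y (filter (\<lambda>t. if y < z then t \<le> z else z \<le> t) zs)"

text \<open>
Lists of heights run from the outermost point of the right half to the innermost one. Beyond the
origin the antipodes follow in reverse order. The antipode of the outermost point is counted
separately because the origin does not obstruct it.
\<close>

definition inward_degree :: "int \<Rightarrow> int list \<Rightarrow> nat" where
  "inward_degree y ys = visible y (ys @ 0 # map uminus (rev ys)) + (if list_all (\<lambda>z. \<bar>y\<bar> < \<bar>z\<bar>) ys then 1 else 0)"

fun degree_bound :: "int list \<Rightarrow> nat" where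
  "degree_bound [] = 0"
| "degree_bound (y # ys) = inward_degree y ys + degree_bound ys"

text \<open>
Everything hidden by the first obstacle may be dropped from the list: the obstacle is nearer to \<open>r\<close>
than the rest of the list, and a point is hidden by it exactly when its height lies beyond that of
the obstacle.
\<close>

lemma card_visible_le:
  assumes "sorted_wrt (\<lambda>p q. fst q < fst p) zs" "\<forall>z\<in>set zs. fst z < fst r \<and> snd z \<noteq> snd r"
  shows "card {z \<in> set zs. snd z \<noteq> 0 \<and> (\<forall>p\<in>set zs. \<not> in_box r z p)} \<le> visible (snd r) (map snd zs)"
  using assms
proof (induction "length zs" arbitrary: zs rule: less_induct)
  case less
  show ?case
  proof (cases zs)
    case Nil
    then show ?thesis by simp
  next
    case (Cons z zs')
    define F where "F = filter (\<lambda>t. if snd r < snd z then snd t \<le> snd z else snd z \<le> snd t) zs'"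
    let ?V = "\<lambda>zs. {z \<in> set zs. snd z \<noteq> 0 \<and> (\<forall>p\<in>set zs. \<not> in_box r z p)}"
    have sub: "set F \<subseteq> set zs'" by (simp add: F_def)
    have V: "?V zs - {z} \<subseteq> ?V F"
    proof
      fix t assume t: "t \<in> ?V zs - {z}"
      then have t': "t \<in> set zs'" "\<not> in_box r t z" "fst t < fst z" "fst z < fst r" "snd z \<noteq> snd r"
        using less.prems by (auto simp: Cons)
      then have "t \<in> set F" by (auto simp: F_def in_box_def strictly_between_def)
      then show "t \<in> ?V F" using t sub by (auto simp: Cons)
    qed
    have "?V zs \<subseteq> (if snd z = 0 then {} else {z}) \<union> ?V F"
      using V by (auto simp: Cons)
    then have "card (?V zs) \<le> card ((if snd z = 0 then {} else {z}) \<union> ?V F)"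
      by (intro card_mono) auto
    also have "\<dots> \<le> card (if snd z = 0 then {} else {z}) + card (?V F)" by (rule card_Un_le)
    also have "card (?V F) \<le> visible (snd r) (map snd F)"
    proof (rule less.hyps)
      show "length F < length zs" by (simp add: F_def Cons le_imp_less_Suc)
      show "sorted_wrt (\<lambda>p q. fst q < fst p) F"
        using less.prems(1) by (simp add: F_def Cons sorted_wrt_filter)
      show "\<forall>z\<in>set F. fst z < fst r \<and> snd z \<noteq> snd r" using less.prems(2) sub by (auto simp: Cons)
    qed
    also have "map snd F = filter (\<lambda>t. if snd r < snd z then t \<le> snd z else snd z \<le> t) (map snd zs')"
      by (simp add: F_def filter_map comp_def)
    finally have "card (?V zs) \<le> card (if snd z = 0 then {} else {z}) +
      visible (snd r) (filter (\<lambda>t. if snd r < snd z then t \<le> snd z else snd z \<le> t) (map snd zs'))"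
      by simp
    moreover have "card (if snd z = 0 then {} else {z}) = (if snd z = 0 then 0 else 1)" by simp
    ultimately show ?thesis unfolding Cons list.map visible.simps by linarith
  qed
qed

lemma card_outermost_nbrs_le:
  assumes sorted: "sorted_wrt (\<lambda>p q. fst q < fst p) (r # qs)" and pos: "\<forall>p\<in>set (r # qs). 0 < fst p"
    and D: "diagram (set (r # qs) \<union> uminus ` set (r # qs))"
  shows "card (nbrs (set (r # qs) \<union> uminus ` set (r # qs)) r) \<le> inward_degree (snd r) (map snd qs)"
proof -
  let ?P = "set (r # qs) \<union> uminus ` set (r # qs)"
  define zs where "zs = qs @ 0 # map uminus (rev qs)"
  let ?V = "{z \<in> set zs. snd z \<noteq> 0 \<and> (\<forall>p\<in>set zs. \<not> in_box r z p)}"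
  let ?c = "if list_all (\<lambda>z. \<bar>snd r\<bar> < \<bar>z\<bar>) (map snd qs) then {- r} else {}"
  have set_zs: "set zs = set qs \<union> {0} \<union> uminus ` set qs" by (auto simp: zs_def)
  have fst_zs: "\<forall>z\<in>set zs. fst z < fst r"
  proof
    fix z assume "z \<in> set zs"
    then consider "z \<in> set qs" | "z = 0" | q where "z = - q" "q \<in> set qs"
      unfolding set_zs by blast
    then show "fst z < fst r"
    proof cases
      case 3
      then have "0 < fst q" "0 < fst r" using pos by simp_all
      then show ?thesis using 3 by simp
    qed (use sorted pos in simp_all)
  qed
  have r: "r \<in> ?P" by simp
  have ne: "\<forall>z\<in>set zs. snd z \<noteq> snd r"
  proof
    fix z assume "z \<in> set zs"
    then consider "z = 0" | "z \<in> ?P" "z \<noteq> r" using fst_zs by (force simp: set_zs)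
    then show "snd z \<noteq> snd r"
    proof cases
      case 1
      then show ?thesis using D r by (auto simp: diagram_def)
    next
      case 2
      then show ?thesis using diagram_distinct[OF D 2(1) r] by blast
    qed
  qed
  have sorted_zs: "sorted_wrt (\<lambda>p q. fst q < fst p) zs"
    unfolding zs_def sorted_wrt_append sorted_wrt.simps sorted_wrt_map sorted_wrt_rev
  proof (intro conjI ballI)
    show "sorted_wrt (\<lambda>x y. fst y < fst x) qs" using sorted by simp
    then show "sorted_wrt (\<lambda>x y. fst (- x) < fst (- y)) qs" by simp
  next
    fix x y assume x: "x \<in> set qs" and "y \<in> set (0 # map uminus (rev qs))"
    then consider "y = 0" | q where "y = - q" "q \<in> set qs" by auto
    then show "fst y < fst x"
    proof cases
      case 2
      then have "0 < fst q" "0 < fst x" using pos x by simp_all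
      then show ?thesis using 2 by simp
    qed (use pos x in simp)
  next
    fix y assume "y \<in> set (map uminus (rev qs))"
    then obtain q where "y = - q" "q \<in> set qs" by auto
    then show "fst y < fst 0" using pos by simp
  qed
  have "nbrs ?P r \<subseteq> ?V \<union> ?c"
  proof
    fix v assume "v \<in> nbrs ?P r"
    then have v: "adj ?P r v" unfolding in_nbrs .
    then have vP: "v \<in> ?P" "v \<noteq> r" using adj_in by blast+
    show "v \<in> ?V \<union> ?c"
    proof (cases "v = - r")
      case True
      have "\<bar>snd r\<bar> < \<bar>snd q\<bar>" if q: "q \<in> set qs" for q
      proof -
        have "q \<in> ?P" "- r \<in> ?P" "q \<noteq> r" using q fst_zs by (auto simp: set_zs)
        moreover have "fst q < fst r" "0 < fst q" using q fst_zs pos by (auto simp: set_zs)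
        moreover have "q \<noteq> - r" using \<open>0 < fst q\<close> pos by force
        ultimately have "\<not> in_box r (- r) q" "snd q \<noteq> snd r" "snd q \<noteq> snd (- r)"
          using adj_box[OF v, of q] diagram_distinct[OF D, of q] r True by blast+
        then show ?thesis
          using \<open>fst q < fst r\<close> \<open>0 < fst q\<close> by (auto simp: in_box_def strictly_between_def)
      qed
      then show ?thesis using True by (simp add: list_all_iff)
    next
      case False
      have "v \<in> set qs \<union> uminus ` set qs" using vP False by auto
      moreover have "snd v \<noteq> 0" using vP(1) D unfolding diagram_def by blast
      moreover have "\<not> in_box r v 0" using v False by (simp add: adj_def)
      moreover have "\<not> in_box r v p" if "p \<in> set qs \<union> uminus ` set qs" for p
        using adj_box[OF v, of p] that by auto
      ultimately have "v \<in> ?V" unfolding set_zs by blast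
      then show ?thesis by (rule UnI1)
    qed
  qed
  then have "card (nbrs ?P r) \<le> card (?V \<union> ?c)" by (intro card_mono) simp_all
  also have "\<dots> \<le> card ?V + card ?c" by (rule card_Un_le)
  also have "card ?V \<le> visible (snd r) (map snd zs)"
    using fst_zs ne by (intro card_visible_le[OF sorted_zs]) blast
  finally show ?thesis
    by (simp add: inward_degree_def zs_def rev_map comp_def split: if_splits)
qed

text \<open>
Removing the outermost pair again and again leaves diagrams in which the degree of the outermost
point is read off from the list of heights.
\<close>

lemma card_edges_le_degree_bound:
  assumes "sorted_wrt (\<lambda>p q. fst q < fst p) ps" "\<forall>p\<in>set ps. 0 < fst p"
    and "diagram (set ps \<union> uminus ` set ps)"
  shows "card (edges (set ps \<union> uminus ` set ps)) \<le> degree_bound (map snd ps)"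
  using assms
proof (induction ps)
  case Nil
  then show ?case by (simp add: edges_def adj_def)
next
  case (Cons r qs)
  let ?P = "set (r # qs) \<union> uminus ` set (r # qs)"
  have "r \<notin> set qs" "- r \<notin> set qs" using Cons.prems(1,2) by force+
  moreover have "x \<notin> uminus ` set qs" if "- x \<notin> set qs" for x using that by force
  ultimately have del: "?P - {r, - r} = set qs \<union> uminus ` set qs" by auto
  have D: "diagram (set qs \<union> uminus ` set qs)"
    using diagram_delete[OF Cons.prems(3), of r] unfolding del .
  have "card (edges ?P) \<le> card (edges (set qs \<union> uminus ` set qs)) + card (nbrs ?P r)"
    using card_edges_delete[OF Cons.prems(3), of r] unfolding del .
  also have "\<dots> \<le> degree_bound (map snd qs) + inward_degree (snd r) (map snd qs)"
    using Cons.prems D by (intro add_mono Cons.IH card_outermost_nbrs_le) simp_all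
  finally show ?case by simp
qed

lemma visible_map:
  assumes "\<And>a b. a \<in> insert y (set zs) \<Longrightarrow> b \<in> insert y (set zs) \<Longrightarrow> h a < h b \<longleftrightarrow> a < b"
    and "\<And>a. a \<in> set zs \<Longrightarrow> h a = 0 \<longleftrightarrow> a = 0"
  shows "visible (h y) (map h zs) = visible y zs"
  using assms
proof (induction "length zs" arbitrary: zs rule: less_induct)
  case less
  show ?case
  proof (cases zs)
    case (Cons z zs')
    let ?F = "filter (\<lambda>t. if y < z then t \<le> z else z \<le> t) zs'"
    have lt: "h a < h b \<longleftrightarrow> a < b" if "a \<in> insert y (set zs)" "b \<in> insert y (set zs)" for a b
      using less.prems(1) that .
    have "filter (\<lambda>t. if h y < h z then t \<le> h z else h z \<le> t) (map h zs') = map h ?F"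
      unfolding filter_map
      by (intro arg_cong[where f = "map h"] filter_cong refl)
        (use lt in \<open>simp add: Cons not_less[symmetric]\<close>)
    moreover have "visible (h y) (map h ?F) = visible y ?F"
      using lt less.prems(2) by (intro less.hyps) (auto simp: Cons le_imp_less_Suc)
    ultimately show ?thesis using less.prems(2)[of z] by (simp add: Cons)
  qed simp
qed

text \<open>
Only the relative order of the heights and their negatives matters, which reduces the case of ten
points to finitely many lists.
\<close>

lemma degree_bound_map:
  assumes "\<And>a b. a \<in> insert 0 (set ys \<union> uminus ` set ys) \<Longrightarrow> b \<in> insert 0 (set ys \<union> uminus ` set ys) \<Longrightarrow>
      h a < h b \<longleftrightarrow> a < b"
    and odd: "\<And>a. h (- a) = - h a"
  shows "degree_bound (map h ys) = degree_bound ys"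
  using assms(1)
proof (induction ys)
  case (Cons y ys)
  have h0: "h 0 = 0" using odd[of 0] by simp
  have lt: "h a < h b \<longleftrightarrow> a < b"
    if "a \<in> insert 0 (set (y # ys) \<union> uminus ` set (y # ys))" "b \<in> insert 0 (set (y # ys) \<union> uminus ` set (y # ys))" for a b
    using Cons.prems that .
  have "visible (h y) (map h (ys @ 0 # map uminus (rev ys))) = visible y (ys @ 0 # map uminus (rev ys))"
  proof (rule visible_map)
    fix a assume "a \<in> set (ys @ 0 # map uminus (rev ys))"
    then have "h a < h 0 \<longleftrightarrow> a < 0" "h 0 < h a \<longleftrightarrow> 0 < a" by (auto intro!: lt)
    then show "h a = 0 \<longleftrightarrow> a = 0" using h0 by linarith
  qed (rule lt; auto)
  moreover have "map h (ys @ 0 # map uminus (rev ys)) = map h ys @ 0 # map uminus (rev (map h ys))"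
    by (simp add: h0 odd rev_map comp_def)
  moreover have "\<bar>h y\<bar> < \<bar>h z\<bar> \<longleftrightarrow> \<bar>y\<bar> < \<bar>z\<bar>" if "z \<in> set ys" for z
  proof -
    have "h a < h b \<longleftrightarrow> a < b" if "a \<in> {0, y, z, - y, - z}" "b \<in> {0, y, z, - y, - z}" for a b
      using that \<open>z \<in> set ys\<close> by (intro lt) auto
    then have "h y < h z \<longleftrightarrow> y < z" "h y < h (- z) \<longleftrightarrow> y < - z" "h (- y) < h z \<longleftrightarrow> - y < z"
      "h (- y) < h (- z) \<longleftrightarrow> - y < - z" "h 0 < h y \<longleftrightarrow> 0 < y" "h 0 < h z \<longleftrightarrow> 0 < z" by simp_all
    then show ?thesis unfolding h0 odd by linarith
  qed
  ultimately have "inward_degree (h y) (map h ys) = inward_degree y ys"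
    by (auto simp: inward_degree_def list_all_iff)
  moreover have "degree_bound (map h ys) = degree_bound ys" by (rule Cons.IH, rule lt; auto)
  ultimately show ?case by simp
qed simp

text \<open>
Search for signed permutations of five values, built up from the innermost entry outward: \<open>k\<close>
entries are still to be chosen, and \<open>t\<close> is the degree bound of the entries \<open>ys\<close> chosen so far.
\<close>

fun all_bounded :: "nat \<Rightarrow> nat \<Rightarrow> int list \<Rightarrow> bool" where
  "all_bounded 0 t ys = (t \<le> 16)"
| "all_bounded (Suc k) t ys = list_all (\<lambda>v. \<bar>v\<bar> \<in> set (map abs ys) \<or> all_bounded k (t + inward_degree v ys) (v # ys))
    [1,-1,2,-2,3,-3,4,-4,5,-5]"

lemma all_bounded_sound:
  assumes "all_bounded (length qs) (degree_bound ys) ys" "distinct (map abs (qs @ ys))" "\<forall>q\<in>set qs. 1 \<le> \<bar>q\<bar> \<and> \<bar>q\<bar> \<le> 5"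
  shows "degree_bound (qs @ ys) \<le> 16"
  using assms
proof (induction qs arbitrary: ys rule: rev_induct)
  case (snoc q qs)
  have "1 \<le> \<bar>q\<bar>" "\<bar>q\<bar> \<le> 5" using snoc.prems(3) by simp_all
  then have "q = 1 \<or> q = -1 \<or> q = 2 \<or> q = -2 \<or> q = 3 \<or> q = -3 \<or> q = 4 \<or> q = -4 \<or> q = 5 \<or> q = -5"
    by arith
  then have "q \<in> set [1,-1,2,-2,3,-3,4,-4,5,-5]" by simp
  moreover have "\<bar>q\<bar> \<notin> set (map abs ys)" using snoc.prems(2) by auto
  ultimately have "all_bounded (length qs) (degree_bound ys + inward_degree q ys) (q # ys)"
    using snoc.prems(1) unfolding length_append_singleton all_bounded.simps list_all_iff by blast
  then have "all_bounded (length qs) (degree_bound (q # ys)) (q # ys)" by (simp only: degree_bound.simps add.commute)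
  then have "degree_bound (qs @ q # ys) \<le> 16"
    using snoc.prems(2,3) by (intro snoc.IH) simp_all
  then show ?case by simp
qed simp

lemma all_bounded_five: "all_bounded 5 0 []"
  by code_simp

text \<open>
The order-preserving renumbering of the heights by \<open>\<plusminus>1, \<plusminus>2, \<dots>\<close>.
\<close>

definition signed_rank :: "int list \<Rightarrow> int \<Rightarrow> int" where
  "signed_rank ys y = sgn y * int (card {z \<in> abs ` set ys. z \<le> \<bar>y\<bar>})"

lemma signed_rank_uminus: "signed_rank ys (- a) = - signed_rank ys a"
  by (simp add: signed_rank_def sgn_minus)

lemma signed_rank_less_iff:
  assumes "a \<in> insert 0 (set ys \<union> uminus ` set ys)" "b \<in> insert 0 (set ys \<union> uminus ` set ys)"
  shows "signed_rank ys a < signed_rank ys b \<longleftrightarrow> a < b"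
proof -
  let ?c = "\<lambda>y. int (card {z \<in> abs ` set ys. z \<le> \<bar>y\<bar>})"
  let ?S = "insert 0 (set ys \<union> uminus ` set ys)"
  have pos: "0 < ?c y" if "y \<in> ?S" "y \<noteq> 0" for y
    using that by (auto simp: card_gt_0_iff)
  have mono: "?c x < ?c y" if "y \<in> ?S" "\<bar>x\<bar> < \<bar>y\<bar>" for x y
  proof -
    have "\<bar>y\<bar> \<in> abs ` set ys" using that by auto
    then have "{z \<in> abs ` set ys. z \<le> \<bar>x\<bar>} \<subset> {z \<in> abs ` set ys. z \<le> \<bar>y\<bar>}" using that(2) by force
    from psubset_card_mono[OF _ this] show ?thesis by simp
  qed
  have "signed_rank ys a < signed_rank ys b" if "a < b" "a \<in> ?S" "b \<in> ?S" for a b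
    using that pos[of a] pos[of b] mono[of b a] mono[of a b]
    by (cases "a < 0"; cases "b < 0"; cases "a = 0"; cases "b = 0") (auto simp: signed_rank_def sgn_if)
  from this[of a b] this[of b a] show ?thesis using assms by (metis linorder_less_linear order_less_asym order_less_irrefl)
qed

lemma abs_signed_rank_eq:
  assumes "x \<in> set ys" "y \<in> set ys" "\<bar>signed_rank ys x\<bar> = \<bar>signed_rank ys y\<bar>"
  shows "\<bar>x\<bar> = \<bar>y\<bar>"
proof -
  have x: "x \<in> insert 0 (set ys \<union> uminus ` set ys)"
    and y: "y \<in> insert 0 (set ys \<union> uminus ` set ys)" "- y \<in> insert 0 (set ys \<union> uminus ` set ys)"
    using assms(1,2) by blast+
  have "signed_rank ys x = signed_rank ys y \<or> signed_rank ys x = signed_rank ys (- y)"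
    using assms(3) unfolding signed_rank_uminus by linarith
  then show ?thesis
    using signed_rank_less_iff[OF x y(1)] signed_rank_less_iff[OF y(1) x] signed_rank_less_iff[OF x y(2)] signed_rank_less_iff[OF y(2) x]
    by linarith
qed

lemma abs_signed_rank_bounds:
  assumes "y \<in> set ys" "y \<noteq> 0"
  shows "1 \<le> \<bar>signed_rank ys y\<bar>" "\<bar>signed_rank ys y\<bar> \<le> int (length ys)"
proof -
  let ?A = "{z \<in> abs ` set ys. z \<le> \<bar>y\<bar>}"
  have r: "\<bar>signed_rank ys y\<bar> = int (card ?A)" using assms(2) by (simp add: signed_rank_def abs_mult abs_sgn_eq)
  have "card ?A \<le> card (abs ` set ys)" by (intro card_mono) auto
  also have "\<dots> \<le> length ys" using card_image_le[of "set ys" abs] card_length[of ys] by simp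
  finally show "\<bar>signed_rank ys y\<bar> \<le> int (length ys)" unfolding r by simp
  have "card ?A > 0" using assms(1) by (auto simp: card_gt_0_iff)
  then show "1 \<le> \<bar>signed_rank ys y\<bar>" unfolding r by simp
qed

lemma degree_bound_five_le:
  assumes "length ys = 5" "distinct (map abs ys)" "0 \<notin> set ys"
  shows "degree_bound ys \<le> 16"
proof -
  let ?zs = "map (signed_rank ys) ys"
  have "length ?zs = 5" using assms(1) by simp
  then have "all_bounded (length ?zs) (degree_bound []) []" using all_bounded_five unfolding degree_bound.simps(1) by metis
  moreover have "distinct (map abs (?zs @ []))"
    using assms(2) abs_signed_rank_eq[of _ ys] unfolding append_Nil2 map_map distinct_map inj_on_def comp_def
    by blast
  moreover have "\<forall>q\<in>set ?zs. 1 \<le> \<bar>q\<bar> \<and> \<bar>q\<bar> \<le> 5"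
  proof
    fix q assume "q \<in> set ?zs"
    then obtain y where y: "y \<in> set ys" "q = signed_rank ys y" unfolding set_map by blast
    then have "y \<noteq> 0" using assms(3) by blast
    then show "1 \<le> \<bar>q\<bar> \<and> \<bar>q\<bar> \<le> 5"
      using abs_signed_rank_bounds[OF y(1)] assms(1) unfolding y(2) by simp
  qed
  ultimately have "degree_bound (?zs @ []) \<le> 16" by (rule all_bounded_sound)
  moreover have "degree_bound ?zs = degree_bound ys" by (rule degree_bound_map[OF signed_rank_less_iff signed_rank_uminus])
  ultimately show ?thesis by simp
qed

lemma card_edges_five:
  assumes D: "diagram P" and card: "card P = 10"
  shows "card (edges P) \<le> 16"
proof -
  let ?Q = "{p \<in> P. 0 < fst p}"
  obtain qs where qs: "set qs = ?Q" "distinct qs"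
    using finite_distinct_list[of ?Q] diagram_finite[OF D] by auto
  define ps where "ps = sort_key (\<lambda>p. - fst p) qs"
  have ps: "set ps = ?Q" "distinct ps" using qs by (simp_all add: ps_def)
  have "inj_on (\<lambda>p. - fst p) ?Q"
    using diagram_distinct[OF D] by (intro inj_onI) (metis (no_types, lifting) mem_Collect_eq neg_equal_iff_equal)
  then have "distinct (map (\<lambda>p. - fst p) ps)"
    using ps by (simp add: distinct_map)
  moreover have "sorted (map (\<lambda>p. - fst p) ps)" by (simp add: ps_def)
  ultimately have "sorted_wrt (<) (map (\<lambda>p. - fst p) ps)" by (simp add: strict_sorted_iff)
  then have sorted: "sorted_wrt (\<lambda>p q. fst q < fst p) ps" unfolding sorted_wrt_map by simp
  have pos: "\<forall>p\<in>set ps. 0 < fst p" unfolding ps(1) by blast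
  have "P = ?Q \<union> uminus ` ?Q"
  proof
    show "P \<subseteq> ?Q \<union> uminus ` ?Q"
    proof
      fix p assume p: "p \<in> P"
      then have "- p \<in> P" "fst p \<noteq> 0" using D by (simp_all add: diagram_def)
      then have "p \<in> ?Q \<or> - p \<in> ?Q" using p by auto
      moreover have "p = - (- p)" by simp
      ultimately show "p \<in> ?Q \<union> uminus ` ?Q" by blast
    qed
    show "?Q \<union> uminus ` ?Q \<subseteq> P" using diagram_uminus[OF D] by blast
  qed
  then have P: "P = set ps \<union> uminus ` set ps" unfolding ps(1) .
  have "card (edges P) \<le> degree_bound (map snd ps)"
    using card_edges_le_degree_bound[OF sorted pos] D unfolding P[symmetric] by blast
  also have "\<dots> \<le> 16"
  proof (rule degree_bound_five_le)
    have "card (set ps) = 5" using card_half(2)[OF D, of 5] card unfolding ps(1) by simp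
    then show "length (map snd ps) = 5" using distinct_card[OF ps(2)] by simp
    have "snd p \<noteq> 0" if "p \<in> P" for p using that D by (simp add: diagram_def)
    then show "0 \<notin> set (map snd ps)" unfolding set_map ps(1) image_iff by (metis (no_types, lifting) mem_Collect_eq)
    have "p = q" if "p \<in> ?Q" "q \<in> ?Q" "\<bar>snd p\<bar> = \<bar>snd q\<bar>" for p q
    proof (rule ccontr)
      assume "p \<noteq> q"
      moreover have "fst p \<noteq> fst (- q)" using that(1,2) by simp
      ultimately have "snd p \<noteq> snd q" "snd p \<noteq> snd (- q)"
        using that diagram_distinct[OF D, of p q] diagram_distinct[OF D, of p "- q"] diagram_uminus[OF D, of q]
        by blast+
      then show False using that(3) by (simp add: abs_eq_iff)
    qed
    then have "inj_on (\<lambda>p. \<bar>snd p\<bar>) (set ps)" unfolding ps(1) by (rule inj_onI)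
    then show "distinct (map abs (map snd ps))"
      using ps(2) by (simp add: distinct_map comp_def)
  qed
  finally show ?thesis .
qed

section \<open>The maximum for all sizes\<close>

text \<open>
The two steps are exact: \<open>f(n) = f(n - 1) + n + 1\<close> for even \<open>n\<close> and \<open>f(n) = f(n - 2) + 2n\<close> always, for
\<open>f(n) = \<lfloor>n\<^sup>2/2\<rfloor> + n - 1\<close>.
\<close>

lemma card_edges_le:
  assumes "n \<ge> 5" "diagram P" "card P = 2 * n"
  shows "card (edges P) \<le> n\<^sup>2 div 2 + n - 1"
  using assms
proof (induction n arbitrary: P rule: less_induct)
  case (less n)
  have "n = 5 \<or> n \<ge> 6 \<and> even n \<or> n \<ge> 7 \<and> odd n" using less.prems(1) by presburger
  then consider "n = 5" | "n \<ge> 6" "even n" | "n \<ge> 7" "odd n" by blast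
  then show ?case
  proof cases
    case 1
    then show ?thesis using card_edges_five[of P] less.prems by simp
  next
    case 2
    obtain k where k: "k \<in> P" "card (nbrs P k) \<le> n + 1"
      using small_degree[OF less.prems(2,3)] less.prems(1) by auto
    have "card (P - {k, - k}) = 2 * (n - 1)"
      using card_delete[OF less.prems(2) k(1)] less.prems(3) by simp
    moreover have "diagram (P - {k, - k})" by (intro diagram_delete less.prems)
    ultimately have "card (edges (P - {k, - k})) \<le> (n - 1)\<^sup>2 div 2 + (n - 1) - 1"
      using less.IH[of "n - 1" "P - {k, - k}"] 2 by simp
    then have "card (edges P) \<le> (n - 1)\<^sup>2 div 2 + (n - 1) - 1 + (n + 1)"
      using card_edges_delete[OF less.prems(2), of k] k(2) by linarith
    also have "\<dots> = n\<^sup>2 div 2 + n - 1"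
    proof -
      obtain m where "n = 2 * m" using 2 by (elim evenE)
      then obtain j where j: "n = 2 * (j + 1)" using 2 by (cases m) auto
      have "(2 * j + 1)\<^sup>2 div 2 = 2 * j * j + 2 * j" "(2 * (j + 1))\<^sup>2 div 2 = 2 * j * j + 4 * j + 2"
        by (simp_all add: power2_eq_square algebra_simps)
      moreover have "n - 1 = 2 * j + 1" using j by simp
      ultimately show ?thesis using j by simp
    qed
    finally show ?thesis .
  next
    case 3
    obtain m where m: "n = 2 * m + 1" using 3 by (elim oddE)
    have sq: "(2 * m + 1)\<^sup>2 div 2 = 2 * m * m + 2 * m" by (simp add: power2_eq_square algebra_simps)
    show ?thesis
    proof (rule odd_step[OF less.prems(2,3) 3(1)])
      fix Q :: "(int \<times> int) set" assume Q: "diagram Q" "card Q = 2 * (n - 2)"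
      have "card (edges Q) \<le> (n - 2)\<^sup>2 div 2 + (n - 2) - 1"
        using less.IH[of "n - 2" Q] Q 3 by simp
      moreover obtain j where "n = 2 * j + 3" using 3(1) m by (cases m) auto
      ultimately show "card (edges Q) + 2 * n \<le> n\<^sup>2 div 2 + n - 1"
        by (simp add: power2_eq_square algebra_simps)
    next
      obtain j where "m = j + 3" using 3(1) m le_Suc_ex[of 3 m] by auto
      then show "(n - 2) * (n - 1) + 4 * n + 2 \<le> 2 * (n\<^sup>2 div 2 + n - 1)"
        unfolding m sq by (simp add: algebra_simps)
    qed
  qed
qed

section \<open>Reflections and inversions of signed permutations\<close>

definition positions :: "nat \<Rightarrow> int set" where
  "positions n = {- int n..int n} - {0}"

text \<open>
All reflections of the hyperoctahedral group have this form, including the sign change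
\<open>signed_swap a (- a)\<close>. Treating \<open>b = -a\<close> uniformly avoids separate computations for the two
conjugacy classes of reflections.
\<close>

definition signed_swap :: "int \<Rightarrow> int \<Rightarrow> int \<Rightarrow> int" where
  "signed_swap a b x = (if x = a then b else if x = b then a else if x = - a then - b else if x = - b then - a else x)"

lemma hyperoctahedral_iff:
  "w \<in> hyperoctahedral n \<longleftrightarrow> w permutes positions n \<and> (\<forall>a. w (- a) = - w a)"
  by (simp add: hyperoctahedral_def positions_def)

lemma signed_swap_involution: "a \<noteq> 0 \<Longrightarrow> b \<noteq> 0 \<Longrightarrow> signed_swap a b (signed_swap a b x) = x"
  by (auto simp: signed_swap_def)

lemma signed_swap_uminus: "a \<noteq> 0 \<Longrightarrow> b \<noteq> 0 \<Longrightarrow> signed_swap a b (- x) = - signed_swap a b x"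
  by (auto simp: signed_swap_def)

lemma uminus_positions: "- a \<in> positions n \<longleftrightarrow> a \<in> positions n"
  by (auto simp: positions_def)

lemma signed_swap_mem:
  assumes "a \<in> positions n" "b \<in> positions n"
  shows "signed_swap a b \<in> hyperoctahedral n"
proof -
  have ne: "a \<noteq> 0" "b \<noteq> 0" using assms by (auto simp: positions_def)
  have "signed_swap a b permutes positions n"
    unfolding permutes_def
  proof (intro conjI allI impI)
    show "signed_swap a b x = x" if "x \<notin> positions n" for x
      using that assms uminus_positions[of a n] uminus_positions[of b n] by (auto simp: signed_swap_def)
    show "\<exists>!x. signed_swap a b x = y" for y using signed_swap_involution[OF ne] by metis
  qed
  then show ?thesis using signed_swap_uminus[OF ne] by (simp add: hyperoctahedral_iff)
qed

lemma signed_swap_commute: "signed_swap a b = signed_swap b a"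
  by (auto simp: signed_swap_def fun_eq_iff)

lemma signed_swap_uminus_uminus: "a \<noteq> 0 \<Longrightarrow> b \<noteq> 0 \<Longrightarrow> signed_swap (- a) (- b) = signed_swap a b"
  by (auto simp: signed_swap_def fun_eq_iff)

lemma comp_signed_swap_twice: "a \<noteq> 0 \<Longrightarrow> b \<noteq> 0 \<Longrightarrow> w \<circ> signed_swap a b \<circ> signed_swap a b = w"
  by (simp add: fun_eq_iff signed_swap_involution)

context
  fixes n :: nat and w :: "int \<Rightarrow> int"
  assumes w: "w \<in> hyperoctahedral n"
begin

lemma signed_uminus: "w (- a) = - w a"
  using w by (simp add: hyperoctahedral_iff)

lemma signed_bij: "bij w"
  using w permutes_bij by (auto simp: hyperoctahedral_iff)

lemma signed_eq_iff: "w a = w b \<longleftrightarrow> a = b"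
  using signed_bij by (simp add: bij_def inj_eq)

lemma signed_zero: "w 0 = 0"
  using signed_uminus[of 0] by simp

lemma signed_mem: "w a \<in> positions n \<longleftrightarrow> a \<in> positions n"
  using w by (simp add: hyperoctahedral_iff permutes_in_image)

lemma signed_outside: "a \<notin> positions n \<Longrightarrow> w a = a"
  using w permutes_not_in unfolding hyperoctahedral_iff by metis

lemma apply_signed_swap: "w (signed_swap a b x) = signed_swap (w a) (w b) (w x)"
  unfolding signed_swap_def signed_uminus[symmetric] signed_eq_iff by simp

lemma comp_signed_swap: "w \<circ> signed_swap a b = signed_swap (w a) (w b) \<circ> w"
  by (simp add: fun_eq_iff apply_signed_swap)

end

lemma hyperoctahedral_comp:
  "v \<in> hyperoctahedral n \<Longrightarrow> w \<in> hyperoctahedral n \<Longrightarrow> v \<circ> w \<in> hyperoctahedral n"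
  by (simp add: hyperoctahedral_iff permutes_compose)

definition pairs :: "nat \<Rightarrow> (int \<times> int) set" where
  "pairs n = {(x, y). x \<in> positions n \<and> y \<in> positions n \<and> x < y}"

text \<open>
Twice the length is a sum over pairs of positions in which an antipodal pair represents itself,
whereas every other pair is accompanied by its antipodal copy. The weight compensates for this.
\<close>

definition pair_weight :: "int \<times> int \<Rightarrow> int" where
  "pair_weight p = (if fst p = - snd p then 2 else 1)"

definition inversion_ind :: "(int \<Rightarrow> int) \<Rightarrow> int \<Rightarrow> int \<Rightarrow> int" where
  "inversion_ind w x y = (if w y < w x then 1 else 0)"

definition twice_length :: "nat \<Rightarrow> (int \<Rightarrow> int) \<Rightarrow> int" where
  "twice_length n w = (\<Sum>p\<in>pairs n. pair_weight p * inversion_ind w (fst p) (snd p))"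

definition reversed :: "nat \<Rightarrow> (int \<Rightarrow> int) \<Rightarrow> (int \<times> int) set" where
  "reversed n t = {p \<in> pairs n. t (snd p) < t (fst p)}"

lemma finite_pairs: "finite (pairs n)"
  by (rule finite_subset[of _ "positions n \<times> positions n"]) (auto simp: pairs_def positions_def)

text \<open>
For a pair of positions whose order \<open>t\<close> preserves, the pair is an inversion of \<open>w \<circ> t\<close> iff its image
is an inversion of \<open>w\<close>, and these pairs are permuted by \<open>t\<close>. For a reversed pair, it is an inversion
of \<open>w \<circ> t\<close> iff the reversed image is not an inversion of \<open>w\<close>.
\<close>

lemma twice_length_comp_signed_swap:
  assumes w: "w \<in> hyperoctahedral n" and a: "a \<in> positions n" and b: "b \<in> positions n"
  defines "t \<equiv> signed_swap a b"
  shows "twice_length n (w \<circ> t) = twice_length n w +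
    (\<Sum>p\<in>reversed n t. pair_weight p * (1 - inversion_ind w (fst p) (snd p) - inversion_ind w (t (snd p)) (t (fst p))))"
proof -
  have t: "t \<in> hyperoctahedral n" unfolding t_def by (rule signed_swap_mem[OF a b])
  have tt: "t (t x) = x" for x using a b by (simp add: t_def positions_def signed_swap_involution)
  let ?R = "reversed n t" and ?N = "pairs n - reversed n t"
  have split: "(\<Sum>p\<in>pairs n. f p) = sum f ?N + sum f ?R" for f :: "int \<times> int \<Rightarrow> int"
    using finite_pairs by (intro sum.subset_diff) (auto simp: reversed_def)
  have ne: "fst p \<noteq> snd p" if "p \<in> pairs n" for p using that by (auto simp: pairs_def)
  have maps: "(t (fst p), t (snd p)) \<in> ?N" if "p \<in> ?N" for p
  proof -
    have "t (fst p) \<le> t (snd p)" "fst p \<noteq> snd p" "fst p \<in> positions n" "snd p \<in> positions n" "fst p < snd p"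
      using that by (auto simp: reversed_def pairs_def)
    moreover from this have "t (fst p) < t (snd p)" using signed_eq_iff[OF t] by (simp add: order_less_le)
    ultimately show ?thesis
      by (auto simp: reversed_def pairs_def tt signed_mem[OF t])
  qed
  have "(\<Sum>p\<in>?N. pair_weight p * inversion_ind (w \<circ> t) (fst p) (snd p)) = (\<Sum>p\<in>?N. pair_weight p * inversion_ind w (fst p) (snd p))"
  proof (rule sum.reindex_bij_witness[where i = "\<lambda>p. (t (fst p), t (snd p))" and j = "\<lambda>p. (t (fst p), t (snd p))"])
    fix p assume "p \<in> ?N"
    have "t (fst p) = - t (snd p) \<longleftrightarrow> fst p = - snd p"
      using signed_eq_iff[OF t, of "fst p" "- snd p"] by (simp add: signed_uminus[OF t])
    then show "pair_weight (t (fst p), t (snd p)) * inversion_ind w (fst (t (fst p), t (snd p))) (snd (t (fst p), t (snd p))) =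
        pair_weight p * inversion_ind (w \<circ> t) (fst p) (snd p)"
      by (simp add: pair_weight_def inversion_ind_def)
  qed (use maps in \<open>simp_all add: tt\<close>)
  moreover have "(\<Sum>p\<in>?R. pair_weight p * inversion_ind (w \<circ> t) (fst p) (snd p)) =
      (\<Sum>p\<in>?R. pair_weight p * (1 - inversion_ind w (t (snd p)) (t (fst p))))"
  proof (rule sum.cong[OF refl])
    fix p assume "p \<in> ?R"
    then have "w (t (fst p)) \<noteq> w (t (snd p))"
      using ne signed_eq_iff[OF t] signed_eq_iff[OF w] by (auto simp: reversed_def)
    then show "pair_weight p * inversion_ind (w \<circ> t) (fst p) (snd p) = pair_weight p * (1 - inversion_ind w (t (snd p)) (t (fst p)))"
      by (simp add: inversion_ind_def)
  qed
  ultimately show ?thesis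
    unfolding twice_length_def split by (simp add: sum.distrib sum_subtractf algebra_simps)
qed

text \<open>
This is adjacency of the two points for \<open>a < b\<close> and \<open>w a < w b\<close>, see \<open>adj_graph_rise\<close>.
\<close>

definition free_rise :: "nat \<Rightarrow> (int \<Rightarrow> int) \<Rightarrow> int \<Rightarrow> int \<Rightarrow> bool" where
  "free_rise n w a b \<longleftrightarrow> (\<forall>k\<in>positions n. \<not> (a < k \<and> k < b \<and> w a < w k \<and> w k < w b)) \<and>
     (a = - b \<or> \<not> (a < 0 \<and> 0 < b \<and> w a < 0 \<and> 0 < w b))"

text \<open>
A reflection adds a multiple of its root: positions and values move simultaneously by the same
multiple \<open>k\<close> of \<open>b - a\<close> and of \<open>w b - w a\<close>.
\<close>

lemma signed_swap_displacement:
  assumes "w \<in> hyperoctahedral n" "a \<noteq> 0" "b \<noteq> 0" "a \<noteq> b"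
  obtains k where "k \<in> {- 1, 0, 1}" "signed_swap a b x = x + k * (b - a)" "w (signed_swap a b x) = w x + k * (w b - w a)"
    "k = 1 \<longleftrightarrow> x \<in> {a, - b}" "k = - 1 \<longleftrightarrow> x \<in> {b, - a}"
proof -
  define k :: int where "k = (if x \<in> {a, - b} then 1 else if x \<in> {b, - a} then - 1 else 0)"
  have "k \<in> {- 1, 0, 1}" "signed_swap a b x = x + k * (b - a)" "w (signed_swap a b x) = w x + k * (w b - w a)"
    "k = 1 \<longleftrightarrow> x \<in> {a, - b}" "k = - 1 \<longleftrightarrow> x \<in> {b, - a}"
    using assms(2-4) by (auto simp: k_def signed_swap_def signed_uminus[OF assms(1)])
  then show ?thesis by (rule that)
qed

text \<open>
Let \<open>x\<close> and \<open>y\<close> be displaced by the multiples \<open>k\<close> and \<open>l\<close>. That the pair is reversed means \<open>l < k\<close>, so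
the values move in the same direction and a pair that is an inversion cannot remain one in the
reversed image. If neither the pair nor its image is an inversion, then a position fixed by the
reflection lies in the box, or the pair is one of \<open>(a, -a)\<close> and \<open>(-b, b)\<close>, which forces the
origin into the box.
\<close>

lemma reversed_cases:
  assumes w: "w \<in> hyperoctahedral n" and ab: "a \<in> positions n" "b \<in> positions n" "a < b" "w a < w b"
    and p: "x \<in> positions n" "y \<in> positions n" "x < y" "signed_swap a b y < signed_swap a b x"
  shows "\<not> (w y < w x \<and> w (signed_swap a b x) < w (signed_swap a b y))"
    "free_rise n w a b \<Longrightarrow> (x, y) \<notin> {(a, b), (- b, - a)} \<Longrightarrow> w y < w x \<or> w (signed_swap a b x) < w (signed_swap a b y)"
proof -
  have nz: "a \<noteq> 0" "b \<noteq> 0" "a \<noteq> b" using ab by (auto simp: positions_def)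
  obtain k where k: "k \<in> {- 1, 0, 1}" "signed_swap a b x = x + k * (b - a)" "w (signed_swap a b x) = w x + k * (w b - w a)"
    "k = 1 \<longleftrightarrow> x \<in> {a, - b}" "k = - 1 \<longleftrightarrow> x \<in> {b, - a}"
    using signed_swap_displacement[OF w nz] .
  obtain l where l: "l \<in> {- 1, 0, 1}" "signed_swap a b y = y + l * (b - a)" "w (signed_swap a b y) = w y + l * (w b - w a)"
    "l = 1 \<longleftrightarrow> y \<in> {a, - b}" "l = - 1 \<longleftrightarrow> y \<in> {b, - a}"
    using signed_swap_displacement[OF w nz] .
  have "l < k" using k(1,2) l(1,2) p(3,4) ab(3) by auto
  then consider "k = 1" "l = 0" | "k = 0" "l = - 1" | "k = 1" "l = - 1" using k(1) l(1) by auto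
  note kl = this
  from kl show "\<not> (w y < w x \<and> w (signed_swap a b x) < w (signed_swap a b y))"
    using ab(4) k(3) l(3) by cases auto
  assume free_rise: "free_rise n w a b" and ne: "(x, y) \<notin> {(a, b), (- b, - a)}"
  show "w y < w x \<or> w (signed_swap a b x) < w (signed_swap a b y)"
  proof (rule ccontr)
    assume *: "\<not> (w y < w x \<or> w (signed_swap a b x) < w (signed_swap a b y))"
    have "w x \<noteq> w y" "w (signed_swap a b x) \<noteq> w (signed_swap a b y)"
      using p signed_eq_iff[OF w] by (metis less_irrefl)+
    then have lt: "w x < w y" "w (signed_swap a b y) < w (signed_swap a b x)" using * by linarith+
    have mid: "\<not> (a < z \<and> z < b \<and> w a < w z \<and> w z < w b)" if "z \<in> positions n" for z
      using free_rise that unfolding free_rise_def by blast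
    from kl show False
    proof cases
      case 1
      then have "x = a \<or> x = - b" "signed_swap a b y = y" using k l by auto
      then show False
        using mid[OF p(2)] mid[of "- y"] p lt 1 k(2,3) by (auto simp: signed_uminus[OF w] uminus_positions)
    next
      case 2
      then have "y = b \<or> y = - a" "signed_swap a b x = x" using k l by auto
      then show False
        using mid[OF p(1)] mid[of "- x"] p lt 2 l(2,3) by (auto simp: signed_uminus[OF w] uminus_positions)
    next
      case 3
      then have "x = a \<or> x = - b" "y = b \<or> y = - a" using k l by auto
      moreover have "a = - b \<or> \<not> (a < 0 \<and> 0 < b \<and> w a < 0 \<and> 0 < w b)"
        using free_rise unfolding free_rise_def by blast
      ultimately show False
        using ne p lt 3 k(2,3) l(2,3) by (auto simp: signed_uminus[OF w])
    qed
  qed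
qed

text \<open>
All terms of the sum in \<open>twice_length_comp_signed_swap\<close> are nonnegative, and the pair \<open>(a, b)\<close> together
with its antipodal copy contributes exactly \<open>2\<close>, also when the two coincide because of the weight.
\<close>

lemma twice_length_rise:
  assumes w: "w \<in> hyperoctahedral n" and ab: "a \<in> positions n" "b \<in> positions n" "a < b" "w a < w b"
  shows "twice_length n w + 2 \<le> twice_length n (w \<circ> signed_swap a b)"
    "free_rise n w a b \<Longrightarrow> twice_length n (w \<circ> signed_swap a b) = twice_length n w + 2"
proof -
  let ?t = "signed_swap a b"
  let ?f = "\<lambda>p. pair_weight p * (1 - inversion_ind w (fst p) (snd p) - inversion_ind w (?t (snd p)) (?t (fst p)))"
  let ?E = "{(a, b), (- b, - a)}"
  have nz: "a \<noteq> 0" "b \<noteq> 0" using ab by (auto simp: positions_def)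
  have E: "?E \<subseteq> reversed n ?t"
    using ab nz by (auto simp: reversed_def pairs_def signed_swap_def uminus_positions)
  have fin: "finite (reversed n ?t)" using finite_pairs by (simp add: reversed_def)
  have "sum ?f ?E = 2"
  proof (cases "a = - b")
    case True
    then show ?thesis using ab by (simp add: pair_weight_def inversion_ind_def signed_swap_def signed_uminus[OF w])
  next
    case False
    then have "(a, b) \<noteq> (- b, - a)" by auto
    then show ?thesis using ab False nz by (auto simp: pair_weight_def inversion_ind_def signed_swap_def signed_uminus[OF w])
  qed
  then have sum: "sum ?f (reversed n ?t) = 2 + sum ?f (reversed n ?t - ?E)"
    using sum.subset_diff[OF E fin, of ?f] by simp
  have mem: "fst p \<in> positions n" "snd p \<in> positions n" "fst p < snd p" "?t (snd p) < ?t (fst p)" if "p \<in> reversed n ?t" for p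
    using that by (auto simp: reversed_def pairs_def)
  have "0 \<le> sum ?f (reversed n ?t - ?E)"
  proof (rule sum_nonneg)
    fix p assume "p \<in> reversed n ?t - ?E"
    then have "\<not> (w (snd p) < w (fst p) \<and> w (?t (fst p)) < w (?t (snd p)))"
      using reversed_cases(1)[OF w ab mem] by blast
    then show "0 \<le> ?f p" by (auto simp: inversion_ind_def pair_weight_def)
  qed
  then show "twice_length n w + 2 \<le> twice_length n (w \<circ> ?t)"
    using sum unfolding twice_length_comp_signed_swap[OF w ab(1,2)] by linarith
  assume free_rise: "free_rise n w a b"
  have "sum ?f (reversed n ?t - ?E) = 0"
  proof (rule sum.neutral, rule ballI)
    fix p assume p: "p \<in> reversed n ?t - ?E"
    then have "\<not> (w (snd p) < w (fst p) \<and> w (?t (fst p)) < w (?t (snd p)))"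
      using reversed_cases(1)[OF w ab mem] by blast
    moreover have "w (snd p) < w (fst p) \<or> w (?t (fst p)) < w (?t (snd p))"
      using reversed_cases(2)[OF w ab mem free_rise] p by simp
    ultimately show "?f p = 0" by (auto simp: inversion_ind_def)
  qed
  then show "twice_length n (w \<circ> ?t) = twice_length n w + 2"
    using sum unfolding twice_length_comp_signed_swap[OF w ab(1,2)] by linarith
qed

section \<open>Length, reflections and Bruhat order\<close>

lemma mem_positions: "a \<in> positions n \<longleftrightarrow> a \<noteq> 0 \<and> \<bar>a\<bar> \<le> int n"
  by (auto simp: positions_def)

lemma hyperoctahedral_gens_eq:
  "hyperoctahedral_gens n = insert (signed_swap (- 1) 1) {signed_swap i (i + 1) |i. 1 \<le> i \<and> i \<le> int n - 1}"
proof -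
  have "transpose 1 (- 1) = signed_swap (- 1) 1"
    by (auto simp: fun_eq_iff signed_swap_def transpose_def)
  moreover have "transpose i (i + 1) \<circ> transpose (- i) (- i - 1) = signed_swap i (i + 1)" if "1 \<le> i" for i :: int
    using that by (auto simp: fun_eq_iff signed_swap_def transpose_def)
  ultimately show ?thesis unfolding hyperoctahedral_gens_def by force
qed

lemma gen_first:
  assumes "n \<ge> 1"
  shows "signed_swap (- 1) 1 \<in> hyperoctahedral_gens n \<and> - 1 \<in> positions n \<and> 1 \<in> positions n \<and> free_rise n w (- 1) 1"
  using assms by (auto simp: hyperoctahedral_gens_eq mem_positions free_rise_def)

lemma gen_Suc:
  assumes "1 \<le> i" "i \<le> int n - 1"
  shows "signed_swap i (i + 1) \<in> hyperoctahedral_gens n \<and> i \<in> positions n \<and> i + 1 \<in> positions n \<and> free_rise n w i (i + 1)"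
  using assms by (auto simp: hyperoctahedral_gens_eq mem_positions free_rise_def)

lemma gens_cases:
  assumes "s \<in> hyperoctahedral_gens n" "n \<ge> 1"
  obtains a b where "s = signed_swap a b" "a \<in> positions n" "b \<in> positions n" "a < b"
    "\<And>w. free_rise n w a b"
proof -
  from assms(1) consider "s = signed_swap (- 1) 1" | i where "s = signed_swap i (i + 1)" "1 \<le> i" "i \<le> int n - 1"
    unfolding hyperoctahedral_gens_eq by blast
  then show ?thesis
  proof cases
    case 1
    show ?thesis
      by (rule that[OF 1]) (use assms(2) in \<open>auto simp: mem_positions free_rise_def\<close>)
  next
    case 2
    show ?thesis
      by (rule that[OF 2(1)]) (use 2 in \<open>auto simp: mem_positions free_rise_def\<close>)
  qed
qed

text \<open>
A simple reflection acts on neighbouring positions, between which there is no room for an obstacle.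
\<close>

lemma twice_length_comp_gen:
  assumes w: "w \<in> hyperoctahedral n" and s: "s = signed_swap a b" "a \<in> positions n" "b \<in> positions n" "a < b" "\<And>w. free_rise n w a b"
  shows "twice_length n (w \<circ> s) = twice_length n w + (if w a < w b then 2 else - 2)"
proof (cases "w a < w b")
  case True
  then show ?thesis using twice_length_rise(2)[OF w s(2-4)] s by simp
next
  case False
  then have lt: "w b < w a" using signed_eq_iff[OF w, of a b] s(4) by simp
  have ws: "w \<circ> s \<in> hyperoctahedral n" unfolding s(1) by (intro hyperoctahedral_comp w signed_swap_mem s)
  have "(w \<circ> s) a < (w \<circ> s) b" using lt s(4) by (simp add: s(1) signed_swap_def)
  from twice_length_rise(2)[OF ws s(2-4) this s(5)]
  have "twice_length n (w \<circ> s \<circ> signed_swap a b) = twice_length n (w \<circ> s) + 2" .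
  moreover have "w \<circ> s \<circ> signed_swap a b = w"
    unfolding s(1) using s(2,3) by (intro comp_signed_swap_twice) (auto simp: mem_positions)
  ultimately show ?thesis using False by simp
qed

lemma foldr_comp: "foldr (\<circ>) ss f = foldr (\<circ>) ss id \<circ> f"
  by (induction ss) (simp_all add: comp_assoc)

lemma twice_length_id: "twice_length n id = 0"
  unfolding twice_length_def by (intro sum.neutral) (auto simp: pairs_def inversion_ind_def)

lemma twice_length_word_le:
  assumes "set ss \<subseteq> hyperoctahedral_gens n" "n \<ge> 1"
  shows "foldr (\<circ>) ss id \<in> hyperoctahedral n \<and> twice_length n (foldr (\<circ>) ss id) \<le> 2 * int (length ss)"
  using assms(1)
proof (induction ss rule: rev_induct)
  case Nil
  have "foldr (\<circ>) [] id = (id :: int \<Rightarrow> int)" by simp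
  show ?case unfolding \<open>foldr (\<circ>) [] id = id\<close> by (simp add: id_in_hyperoctahedral twice_length_id flip: id_def)
next
  case (snoc s ss)
  obtain a b where ab: "s = signed_swap a b" "a \<in> positions n" "b \<in> positions n" "a < b" "\<And>w. free_rise n w a b"
    using gens_cases[OF _ assms(2)] snoc.prems by auto
  define v where "v = foldr (\<circ>) ss id"
  have eq: "foldr (\<circ>) (ss @ [s]) id = v \<circ> s"
    using foldr_comp[of ss s] by (simp add: v_def)
  have v: "v \<in> hyperoctahedral n" "twice_length n v \<le> 2 * int (length ss)"
    using snoc.IH snoc.prems unfolding set_append v_def by blast+
  have "v \<circ> s \<in> hyperoctahedral n" unfolding ab(1) by (intro hyperoctahedral_comp v signed_swap_mem ab)
  moreover have "twice_length n (v \<circ> s) \<le> twice_length n v + 2" unfolding twice_length_comp_gen[OF v(1) ab] by simp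
  then have "twice_length n (v \<circ> s) \<le> 2 * int (length (ss @ [s]))" using v(2) by simp
  ultimately show ?case by (simp only: eq simp_thms)
qed

text \<open>
The entries at \<open>1, \<dots>, n\<close> form a strictly increasing sequence of integers in \<open>{1..n}\<close>.
\<close>

lemma no_descent_id:
  assumes w: "w \<in> hyperoctahedral n" and pos: "0 < w 1" and inc: "\<And>i. 1 \<le> i \<Longrightarrow> i \<le> int n - 1 \<Longrightarrow> w i < w (i + 1)"
  shows "w = id"
proof -
  have lower: "int k \<le> w (int k)" if "1 \<le> k" "k \<le> n" for k
    using that
  proof (induction k rule: nat_induct_at_least)
    case base
    then show ?case using pos by simp
  next
    case (Suc k)
    then show ?case using inc[of "int k"] by (simp add: add.commute)
  qed
  have upper: "w (int n - int k) \<le> int n - int k" if "k < n" for k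
    using that
  proof (induction k)
    case 0
    then have "w (int n) \<in> positions n" using signed_mem[OF w] by (simp add: mem_positions)
    then show ?case by (simp add: mem_positions abs_le_iff)
  next
    case (Suc k)
    then show ?case using inc[of "int n - int (Suc k)"] by simp
  qed
  have fix_pos: "w x = x" if "1 \<le> x" "x \<le> int n" for x
  proof -
    have "0 \<le> x" using that(1) by simp
    from zero_le_imp_eq_int[OF this] obtain k where k: "x = int k" by blast
    then have "int n - int (n - k) = x" using that by simp
    then show ?thesis using lower[of k] upper[of "n - k"] that k by simp
  qed
  show ?thesis
  proof
    fix x
    have "x \<notin> positions n \<or> 1 \<le> x \<and> x \<le> int n \<or> 1 \<le> - x \<and> - x \<le> int n"
      unfolding mem_positions by linarith
    then consider "x \<notin> positions n" | "1 \<le> x" "x \<le> int n" | "1 \<le> - x" "- x \<le> int n" by blast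
    then show "w x = id x"
      using signed_outside[OF w] fix_pos[of x] fix_pos[of "- x"] signed_uminus[OF w, of x] by cases auto
  qed
qed

lemma reduced_word:
  assumes "w \<in> hyperoctahedral n" "n \<ge> 1"
  shows "\<exists>ss. set ss \<subseteq> hyperoctahedral_gens n \<and> foldr (\<circ>) ss id = w \<and> 2 * int (length ss) = twice_length n w"
  using assms(1)
proof (induction "nat (twice_length n w)" arbitrary: w rule: less_induct)
  case less
  note w = less.prems
  have nonneg: "0 \<le> twice_length n v" for v unfolding twice_length_def by (intro sum_nonneg) (simp add: pair_weight_def inversion_ind_def)
  show ?case
  proof (cases "w = id")
    case True
    then show ?thesis by (intro exI[of _ "[]"]) (simp add: twice_length_id)
  next
    case False
    then have "\<exists>a b. signed_swap a b \<in> hyperoctahedral_gens n \<and> a \<in> positions n \<and> b \<in> positions n \<and> a < b \<and> (\<forall>w. free_rise n w a b) \<and> \<not> w a < w b"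
    proof (rule contrapos_np)
      assume *: "\<not> ?thesis"
      show "w = id"
      proof (rule no_descent_id[OF w])
        have "w (- 1) < w 1"
          using * gen_first[OF assms(2)] by (metis less_minus_one_simps(1) zero_less_one order.strict_trans)
        then show "0 < w 1" using signed_uminus[OF w, of 1] by simp
        show "w i < w (i + 1)" if "1 \<le> i" "i \<le> int n - 1" for i
          using * gen_Suc[OF that] less_add_one[of i] by blast
      qed
    qed
    then obtain a b where gen: "signed_swap a b \<in> hyperoctahedral_gens n" and ab: "a \<in> positions n" "b \<in> positions n" "a < b" "\<And>w. free_rise n w a b"
      and desc: "\<not> w a < w b" by blast
    let ?v = "w \<circ> signed_swap a b"
    have v: "?v \<in> hyperoctahedral n" by (intro hyperoctahedral_comp w signed_swap_mem ab)
    have d: "twice_length n ?v = twice_length n w - 2" using twice_length_comp_gen[OF w refl ab] desc by simp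
    then have "nat (twice_length n ?v) < nat (twice_length n w)" using nonneg[of ?v] by linarith
    from less.hyps[OF this v] obtain ss where ss: "set ss \<subseteq> hyperoctahedral_gens n" "foldr (\<circ>) ss id = ?v"
      "2 * int (length ss) = twice_length n ?v" by blast
    have "foldr (\<circ>) (ss @ [signed_swap a b]) id = ?v \<circ> signed_swap a b"
      using foldr_comp[of ss "signed_swap a b"] ss(2) by simp
    also have "\<dots> = w" using ab by (intro comp_signed_swap_twice) (auto simp: mem_positions)
    finally show ?thesis
      using ss gen d by (intro exI[of _ "ss @ [signed_swap a b]"]) simp
  qed
qed

text \<open>
A factor changes twice the length by at most \<open>2\<close>, and a signed permutation other than the identity
has a descent, at which a factor can be split off.
\<close>

lemma cox_length_eq:
  assumes "w \<in> hyperoctahedral n" "n \<ge> 1"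
  shows "2 * int (cox_length (hyperoctahedral_gens n) w) = twice_length n w"
proof -
  obtain ss where ss: "set ss \<subseteq> hyperoctahedral_gens n" "foldr (\<circ>) ss id = w" "2 * int (length ss) = twice_length n w"
    using reduced_word[OF assms] by blast
  have "cox_length (hyperoctahedral_gens n) w = length ss"
    unfolding cox_length_def
  proof (rule Least_equality)
    show "\<exists>ts. length ts = length ss \<and> set ts \<subseteq> hyperoctahedral_gens n \<and> foldr (\<circ>) ts id = w"
      using ss by blast
    show "length ss \<le> k"
      if "\<exists>ts. length ts = k \<and> set ts \<subseteq> hyperoctahedral_gens n \<and> foldr (\<circ>) ts id = w" for k
      using that twice_length_word_le[OF _ assms(2)] ss(3) by force
  qed
  then show ?thesis using ss(3) by simp
qed

lemma conj_signed_swap: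
  assumes "w \<in> hyperoctahedral n"
  shows "w \<circ> signed_swap a b \<circ> inv w = signed_swap (w a) (w b)"
  unfolding comp_signed_swap[OF assms] comp_assoc
  using surj_iff[of w] signed_bij[OF assms] by (simp add: bij_def)

text \<open>
Conjugation by \<open>w\<close> moves \<open>signed_swap a b\<close> to \<open>signed_swap (w a) (w b)\<close>. For the converse inclusion
a group element is needed that sends \<open>1\<close> (and \<open>2\<close>) to prescribed positions; it is composed of at most
two signed swaps.
\<close>

lemma reflections_hyperoctahedral:
  assumes "n \<ge> 1"
  shows "reflections (hyperoctahedral n) (hyperoctahedral_gens n) = {signed_swap a b |a b. a \<in> positions n \<and> b \<in> positions n \<and> a \<noteq> b}"
proof (intro equalityI subsetI)
  fix t assume "t \<in> reflections (hyperoctahedral n) (hyperoctahedral_gens n)"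
  then obtain w s where ws: "t = w \<circ> s \<circ> inv w" "w \<in> hyperoctahedral n" "s \<in> hyperoctahedral_gens n"
    by (auto simp: reflections_def)
  obtain a b where "s = signed_swap a b" "a \<in> positions n" "b \<in> positions n" "a < b"
    using gens_cases[OF ws(3) assms] by blast
  then show "t \<in> {signed_swap a b |a b. a \<in> positions n \<and> b \<in> positions n \<and> a \<noteq> b}"
    using conj_signed_swap[OF ws(2)] signed_mem[OF ws(2)] signed_eq_iff[OF ws(2), of a b] ws(1)
    by (intro CollectI exI[of _ "w a"] exI[of _ "w b"]) simp
next
  fix t assume "t \<in> {signed_swap a b |a b. a \<in> positions n \<and> b \<in> positions n \<and> a \<noteq> b}"
  then obtain a b where t: "t = signed_swap a b" "a \<in> positions n" "b \<in> positions n" "a \<noteq> b" by blast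
  have "1 \<in> positions n" using assms by (simp add: mem_positions)
  have "\<exists>v\<in>hyperoctahedral n. v 1 = a"
  proof (cases "a = 1")
    case True
    then show ?thesis using id_in_hyperoctahedral by (intro bexI[of _ id]) auto
  next
    case False
    then show ?thesis using signed_swap_mem[OF \<open>1 \<in> positions n\<close> t(2)] by (intro bexI[of _ "signed_swap 1 a"]) (auto simp: signed_swap_def)
  qed
  then obtain v where v: "v \<in> hyperoctahedral n" "v 1 = a" by blast
  have conj: "signed_swap (w c) (w d) \<in> reflections (hyperoctahedral n) (hyperoctahedral_gens n)"
    if "w \<in> hyperoctahedral n" "signed_swap c d \<in> hyperoctahedral_gens n" for w c d
  proof -
    have "w \<circ> signed_swap c d \<circ> inv w \<in> reflections (hyperoctahedral n) (hyperoctahedral_gens n)"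
      unfolding reflections_def using that by blast
    then show ?thesis unfolding conj_signed_swap[OF that(1)] .
  qed
  show "t \<in> reflections (hyperoctahedral n) (hyperoctahedral_gens n)"
  proof (cases "b = - a")
    case True
    have "signed_swap (v (- 1)) (v 1) \<in> reflections (hyperoctahedral n) (hyperoctahedral_gens n)"
      using v by (intro conj) (simp_all add: hyperoctahedral_gens_eq)
    then show ?thesis using True v t by (simp add: signed_uminus[OF v(1)] signed_swap_commute[of "- a"])
  next
    case False
    then have n2: "n \<ge> 2" using t by (auto simp: mem_positions)
    obtain c where c: "v c = b" using signed_bij[OF v(1)] by (metis bij_pointE)
    then have c': "c \<in> positions n" "c \<noteq> 1" "c \<noteq> - 1"
      using signed_mem[OF v(1), of c] t v False signed_uminus[OF v(1), of 1] by auto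
    have "2 \<in> positions n" using n2 by (simp add: mem_positions)
    have "\<exists>u\<in>hyperoctahedral n. u 1 = 1 \<and> u 2 = c"
    proof (cases "c = 2")
      case True
      then show ?thesis using id_in_hyperoctahedral by (intro bexI[of _ id]) auto
    next
      case False
      then show ?thesis using signed_swap_mem[OF \<open>2 \<in> positions n\<close> c'(1)] c'
        by (intro bexI[of _ "signed_swap 2 c"]) (auto simp: signed_swap_def)
    qed
    then obtain u where u: "u \<in> hyperoctahedral n" "u 1 = 1" "u 2 = c" by blast
    have "signed_swap 1 2 \<in> hyperoctahedral_gens n"
      unfolding hyperoctahedral_gens_eq using n2 by (intro insertI2 CollectI exI[of _ 1]) simp
    from conj[OF hyperoctahedral_comp[OF v(1) u(1)] this] show ?thesis using u v c t(1) by simp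
  qed
qed

text \<open>
A reflection on the left is a reflection on the right, with positions instead of values, and the
comparison of lengths becomes a comparison of two values.
\<close>

definition rises :: "nat \<Rightarrow> (int \<Rightarrow> int) \<Rightarrow> (int \<Rightarrow> int) \<Rightarrow> bool" where
  "rises n u v \<longleftrightarrow> u \<in> hyperoctahedral n \<and>
     (\<exists>a\<in>positions n. \<exists>b\<in>positions n. a < b \<and> u a < u b \<and> v = u \<circ> signed_swap a b)"

lemma twice_length_rises: "rises n u v \<Longrightarrow> twice_length n u + 2 \<le> twice_length n v"
  using twice_length_rise(1) by (auto simp: rises_def)

lemma rises_mem: "rises n u v \<Longrightarrow> u \<in> hyperoctahedral n \<and> v \<in> hyperoctahedral n"
  using hyperoctahedral_comp signed_swap_mem by (auto simp: rises_def)

lemma risesI: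
  assumes "u \<in> hyperoctahedral n" "a \<in> positions n" "b \<in> positions n" "a < b" "u a < u b"
  shows "rises n u (u \<circ> signed_swap a b)"
  using assms by (auto simp: rises_def)

lemma bruhat_step_rises:
  assumes "n \<ge> 1"
  shows "bruhat_step (hyperoctahedral n) (hyperoctahedral_gens n) = {(u, v). rises n u v}"
proof (intro equalityI subrelI)
  let ?W = "hyperoctahedral n" and ?S = "hyperoctahedral_gens n"
  fix u v assume "(u, v) \<in> bruhat_step ?W ?S"
  then obtain t where t: "u = t \<circ> v" "t \<in> reflections ?W ?S" and v: "v \<in> ?W"
    and less: "cox_length ?S u < cox_length ?S v"
    by (auto simp: bruhat_step_def)
  from t(2) obtain c d where cd: "t = signed_swap c d" "c \<in> positions n" "d \<in> positions n" "c \<noteq> d"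
    unfolding reflections_hyperoctahedral[OF assms] by blast
  obtain a b where vab: "v a = c" "v b = d" using signed_bij[OF v] by (metis bij_pointE)
  have mem: "a \<in> positions n" "b \<in> positions n" using cd(2,3) unfolding vab[symmetric] signed_mem[OF v] .
  have u_eq: "u = v \<circ> signed_swap a b" "a \<noteq> b"
    using t(1) cd(1,4) comp_signed_swap[OF v, of a b] vab by auto
  then have u_eq': "u = v \<circ> signed_swap b a" by (simp only: signed_swap_commute)
  then have "\<exists>a\<in>positions n. \<exists>b\<in>positions n. a < b \<and> u = v \<circ> signed_swap a b"
    using mem u_eq u_eq' less_linear[of a b] by blast
  then obtain a b where ab: "a \<in> positions n" "b \<in> positions n" "a < b" "u = v \<circ> signed_swap a b" by blast
  have u: "u \<in> ?W" unfolding ab(4) by (intro hyperoctahedral_comp v signed_swap_mem ab)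
  have "\<not> v a < v b"
    using twice_length_rise(1)[OF v ab(1-3)] less cox_length_eq[OF u assms] cox_length_eq[OF v assms]
    unfolding ab(4) by linarith
  then have "v b < v a" using signed_eq_iff[OF v, of a b] ab(3) by simp
  then have "u a < u b" using ab by (simp add: signed_swap_def)
  then have "rises n u (u \<circ> signed_swap a b)" by (rule risesI[OF u ab(1-3)])
  moreover have "u \<circ> signed_swap a b = v"
    unfolding ab(4) using ab(1,2) by (intro comp_signed_swap_twice) (auto simp: mem_positions)
  ultimately show "(u, v) \<in> {(u, v). rises n u v}" by (simp only: mem_Collect_eq case_prod_conv)
next
  let ?W = "hyperoctahedral n" and ?S = "hyperoctahedral_gens n"
  fix u v assume "(u, v) \<in> {(u, v). rises n u v}"
  then have r: "rises n u v" by simp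
  then obtain a b where ab: "a \<in> positions n" "b \<in> positions n" "a < b" "u a < u b" "v = u \<circ> signed_swap a b"
    unfolding rises_def by blast
  have uv: "u \<in> ?W" "v \<in> ?W" using rises_mem[OF r] by blast+
  have "u = v \<circ> signed_swap a b"
    unfolding ab(5) using ab(1,2) by (intro comp_signed_swap_twice[symmetric]) (auto simp: mem_positions)
  then have "u = signed_swap (v a) (v b) \<circ> v" by (simp only: comp_signed_swap[OF uv(2)])
  moreover have "signed_swap (v a) (v b) \<in> reflections ?W ?S"
    unfolding reflections_hyperoctahedral[OF assms]
    using ab(1-3) signed_mem[OF uv(2)] signed_eq_iff[OF uv(2), of a b]
    by (intro CollectI exI[of _ "v a"] exI[of _ "v b"]) simp
  moreover have "cox_length ?S u < cox_length ?S v"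
    using twice_length_rises[OF r] cox_length_eq[OF uv(1) assms] cox_length_eq[OF uv(2) assms] by linarith
  ultimately show "(u, v) \<in> bruhat_step ?W ?S" unfolding bruhat_step_def using uv(2) by blast
qed

section \<open>Covers in the Bruhat order\<close>

lemma rises_comp:
  assumes "u \<in> hyperoctahedral n" "a \<in> positions n" "b \<in> positions n" "a < b" "u a < u b" "v = u \<circ> signed_swap a b"
  shows "rises n u v"
  using risesI[OF assms(1-5)] assms(6) by simp

text \<open>
A reflection that is a product of three others, each of which goes up, has elements strictly between
its two ends.
\<close>

lemma three_rises:
  assumes w: "w \<in> hyperoctahedral n"
    and positions: "a \<in> positions n" "b \<in> positions n" "c \<in> positions n" "d \<in> positions n" "e \<in> positions n" "f \<in> positions n"
    and 1: "a < b" "w a < w b"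
    and 2: "c < d" "w (signed_swap a b c) < w (signed_swap a b d)"
    and 3: "e < f" "w (signed_swap a b (signed_swap c d e)) < w (signed_swap a b (signed_swap c d f))"
    and eq: "\<And>x. signed_swap a b (signed_swap c d (signed_swap e f x)) = t x"
  shows "\<exists>z z'. rises n w z \<and> rises n z z' \<and> rises n z' (w \<circ> t)"
proof -
  let ?z = "w \<circ> signed_swap a b" and ?z' = "w \<circ> signed_swap a b \<circ> signed_swap c d"
  have z: "rises n w ?z" by (rule risesI[OF w positions(1,2) 1])
  then have z_mem: "?z \<in> hyperoctahedral n" using rises_mem by blast
  have z': "rises n ?z ?z'" by (rule risesI[OF z_mem positions(3,4) 2(1)]) (simp add: 2)
  then have z'_mem: "?z' \<in> hyperoctahedral n" using rises_mem by blast
  have "rises n ?z' (w \<circ> t)"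
    by (rule rises_comp[OF z'_mem positions(5,6) 3(1)]) (simp_all add: 3 fun_eq_iff eq)
  with z z' show ?thesis by blast
qed

text \<open>
There are three kinds of obstacles. A point in general position in the box is passed by the
three exchanges of three entries \<open>(\<alpha>, \<kappa>, \<beta>) \<rightarrow> (\<kappa>, \<alpha>, \<beta>) \<rightarrow> (\<kappa>, \<beta>, \<alpha>) \<rightarrow> (\<beta>, \<kappa>, \<alpha>)\<close>. An obstacle of a
sign change at \<open>b\<close> is an inner position with a smaller absolute value. If the origin
obstructs, both entries have the same sign at positive positions; they are exchanged and then have their
signs changed one after the other, or conversely.
\<close>

lemma not_free_intermediate:
  assumes w: "w \<in> hyperoctahedral n" and ab: "a \<in> positions n" "b \<in> positions n" "a < b" "w a < w b"
    and nfree: "\<not> free_rise n w a b"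
  shows "\<exists>z z'. rises n w z \<and> rises n z z' \<and> rises n z' (w \<circ> signed_swap a b)"
proof -
  note odd = signed_uminus[OF w]
  have nz: "a \<noteq> 0" "b \<noteq> 0" using ab by (auto simp: positions_def)
  have origin: ?thesis if "0 < p" "p < q" "p \<in> positions n" "q \<in> positions n" "0 < w p" "0 < w q"
    "signed_swap a b = signed_swap (- p) q" for p q
  proof -
    have n: "- p \<in> positions n" "- q \<in> positions n" using that uminus_positions by auto
    show ?thesis
    proof (cases "w p < w q")
      case True
      show ?thesis unfolding that(7)
        by (rule three_rises[OF w, of p q "- p" p "- q" q])
          (use that n True in \<open>auto simp: signed_swap_def odd\<close>)
    next
      case False
      then have "w q < w p" using that signed_eq_iff[OF w, of p q] by auto
      then show ?thesis unfolding that(7)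
        by (intro three_rises[OF w, of "- p" p "- q" q p q])
          (use that n in \<open>auto simp: signed_swap_def odd\<close>)
    qed
  qed
  show ?thesis
  proof (cases "a \<noteq> - b \<and> a < 0 \<and> 0 < b \<and> w a < 0 \<and> 0 < w b")
    case True
    then have *: "- a \<noteq> b" "0 < - a" "0 < w (- a)" by (auto simp: odd)
    show ?thesis
    proof (cases "- a < b")
      case True
      then show ?thesis
        using origin[of "- a" b] * ab \<open>a \<noteq> - b \<and> _\<close> by (simp add: uminus_positions)
    next
      case False
      then have "b < - a" using * by simp
      moreover have "signed_swap a b = signed_swap (- b) (- a)"
        using signed_swap_uminus_uminus[OF nz] signed_swap_commute by metis
      ultimately show ?thesis
        using origin[of b "- a"] * ab \<open>a \<noteq> - b \<and> _\<close> by (simp add: uminus_positions)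
    qed
  next
    case False
    then obtain k where k: "k \<in> positions n" "a < k" "k < b" "w a < w k" "w k < w b"
      using nfree unfolding free_rise_def by blast
    have "k \<noteq> 0" using k by (simp add: positions_def)
    show ?thesis
    proof (cases "a = - b")
      case True
      \<comment> \<open>The sign of the value at the positive inner position decides whether its sign is changed
        last or first.\<close>
      define l where "l = \<bar>k\<bar>"
      have l: "0 < l" "l < b" "l \<in> positions n" "- l \<in> positions n" "- w b < w l" "w l < w b" "w l \<noteq> 0"
        using k True \<open>k \<noteq> 0\<close> signed_eq_iff[OF w, of l 0] signed_zero[OF w]
        by (auto simp: l_def odd uminus_positions abs_if split: if_splits)
      have nb: "- b \<in> positions n" using ab uminus_positions by auto
      show ?thesis
      proof (cases "w l < 0")
        case True
        show ?thesis unfolding \<open>a = - b\<close>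
          by (rule three_rises[OF w, of "- b" l l b "- l" l])
            (use l ab nb True in \<open>auto simp: signed_swap_def odd\<close>)
      next
        case False
        show ?thesis unfolding \<open>a = - b\<close>
          by (rule three_rises[OF w, of "- l" l "- b" l l b])
            (use l ab nb False in \<open>auto simp: signed_swap_def odd\<close>)
      qed
    next
      case False
      have "k \<noteq> - a" "k \<noteq> - b"
        using \<open>\<not> (a \<noteq> - b \<and> a < 0 \<and> 0 < b \<and> w a < 0 \<and> 0 < w b)\<close> False k by (auto simp: odd)
      then show ?thesis
        by (intro three_rises[OF w, of a k k b a k])
          (use k ab nz False \<open>k \<noteq> 0\<close> in \<open>auto simp: signed_swap_def odd\<close>)
    qed
  qed
qed

lemma twice_length_rises_rtrancl:
  assumes "(u, v) \<in> {(u, v). rises n u v}\<^sup>*" "u \<noteq> v"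
  shows "twice_length n u + 2 \<le> twice_length n v"
proof -
  have "u = v \<or> twice_length n u + 2 \<le> twice_length n v"
    using assms(1)
  proof (induction rule: rtrancl_induct)
    case (step y z)
    then show ?case using twice_length_rises[of n y z] by force
  qed simp
  then show ?thesis using assms(2) by blast
qed

lemma bruhat_less_rises:
  assumes "n \<ge> 1"
  shows "bruhat_less (hyperoctahedral n) (hyperoctahedral_gens n) u v \<longleftrightarrow>
    u \<in> hyperoctahedral n \<and> v \<in> hyperoctahedral n \<and> (u, v) \<in> {(u, v). rises n u v}\<^sup>* \<and> u \<noteq> v"
  by (auto simp: bruhat_less_def bruhat_le_def bruhat_step_rises[OF assms])

text \<open>
An element above another one by exactly \<open>2\<close> in \<open>twice_length\<close> covers it, since every step adds at least \<open>2\<close>.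
Conversely, a cover is a single step, and a step that is not free has an intermediate element.
\<close>

lemma bruhat_covers_iff:
  assumes n: "n \<ge> 1"
  shows "bruhat_covers (hyperoctahedral n) (hyperoctahedral_gens n) v u \<longleftrightarrow>
    u \<in> hyperoctahedral n \<and>
    (\<exists>a\<in>positions n. \<exists>b\<in>positions n. a < b \<and> u a < u b \<and> free_rise n u a b \<and> v = u \<circ> signed_swap a b)"
    (is "?cov v u \<longleftrightarrow> ?R")
proof
  let ?less = "bruhat_less (hyperoctahedral n) (hyperoctahedral_gens n)"
  have rises_less: "?less u v" if "rises n u v" for u v
    using rises_mem[OF that] twice_length_rises[OF that] that by (auto simp: bruhat_less_rises[OF n])
  {
    assume "?cov v u"
    then have less: "?less u v" and no: "\<And>z. \<not> (?less u z \<and> ?less z v)"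
      by (auto simp: bruhat_covers_def)
    from less have uv: "(u, v) \<in> {(u, v). rises n u v}\<^sup>*" "u \<noteq> v" "v \<in> hyperoctahedral n"
      by (auto simp: bruhat_less_rises[OF n])
    from uv(1,2) obtain z where z: "rises n u z" "(z, v) \<in> {(u, v). rises n u v}\<^sup>*"
      by (auto elim: converse_rtranclE)
    have "z = v"
      using no[of z] rises_less[OF z(1)] z(2) rises_mem[OF z(1)] uv(3) by (auto simp: bruhat_less_rises[OF n])
    with z(1) obtain a b where ab: "u \<in> hyperoctahedral n" "a \<in> positions n" "b \<in> positions n" "a < b" "u a < u b"
      "v = u \<circ> signed_swap a b"
      unfolding rises_def by blast
    moreover have "free_rise n u a b"
    proof (rule ccontr)
      assume "\<not> free_rise n u a b"
      from not_free_intermediate[OF ab(1-5) this] obtain y y' where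
        y: "rises n u y" "rises n y y'" "rises n y' v"
        unfolding ab(6) by blast
      then have "(y, v) \<in> {(u, v). rises n u v}\<^sup>*"
        by (meson CollectI case_prodI converse_rtrancl_into_rtrancl r_into_rtrancl)
      moreover have "y \<noteq> v" using twice_length_rises[OF y(2)] twice_length_rises[OF y(3)] by auto
      ultimately have "?less y v"
        using rises_mem[OF y(1)] uv(3) by (simp add: bruhat_less_rises[OF n])
      then show False using no rises_less[OF y(1)] by blast
    qed
    ultimately show ?R by blast
  next
    assume ?R
    then obtain a b where u: "u \<in> hyperoctahedral n" and ab: "a \<in> positions n" "b \<in> positions n" "a < b" "u a < u b"
      "free_rise n u a b" and v: "v = u \<circ> signed_swap a b" by blast
    have d: "twice_length n v = twice_length n u + 2" unfolding v by (rule twice_length_rise(2)[OF u ab])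
    have "?less u v" using rises_comp[OF u ab(1-4) v] rises_less by blast
    moreover have "\<not> (?less u z \<and> ?less z v)" for z
      using twice_length_rises_rtrancl[of u z n] twice_length_rises_rtrancl[of z v n] d
      unfolding bruhat_less_rises[OF n] by force
    ultimately show "?cov v u" by (auto simp: bruhat_covers_def)
  }
qed

section \<open>Covers as edges of the diagram\<close>

definition graph :: "nat \<Rightarrow> (int \<Rightarrow> int) \<Rightarrow> (int \<times> int) set" where
  "graph n w = (\<lambda>i. (i, w i)) ` positions n"

lemma card_positions: "card (positions n) = 2 * n"
proof -
  have "card (positions n) = card {- int n..int n} - 1"
    unfolding positions_def by (subst card_Diff_singleton) auto
  then show ?thesis by simp
qed

lemma diagram_graph:
  assumes w: "w \<in> hyperoctahedral n"
  shows "diagram (graph n w)" "card (graph n w) = 2 * n"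
proof -
  have "inj_on fst (graph n w)" "inj_on snd (graph n w)"
    using signed_eq_iff[OF w] by (auto simp: graph_def inj_on_def)
  moreover have "finite (graph n w)" by (simp add: graph_def positions_def)
  moreover have "- p \<in> graph n w \<and> fst p \<noteq> 0 \<and> snd p \<noteq> 0" if "p \<in> graph n w" for p
  proof -
    from that obtain i where i: "i \<in> positions n" "p = (i, w i)" unfolding graph_def by blast
    have "- p = (- i, w (- i))" using i signed_uminus[OF w] by simp
    moreover have "w i \<in> positions n" using i signed_mem[OF w] by simp
    ultimately show ?thesis using i uminus_positions[of i n] by (auto simp: graph_def mem_positions)
  qed
  ultimately show "diagram (graph n w)" by (simp add: diagram_def)
  have "inj_on (\<lambda>i. (i, w i)) (positions n)" by (rule inj_onI) simp
  then show "card (graph n w) = 2 * n" unfolding graph_def by (simp add: card_image card_positions)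
qed

lemma adj_graph_iff:
  assumes w: "w \<in> hyperoctahedral n" and ab: "a \<in> positions n" "b \<in> positions n" "a < b"
  shows "adj (graph n w) (a, w a) (b, w b) \<longleftrightarrow>
    (\<forall>k\<in>positions n. a < k \<and> k < b \<longrightarrow> \<not> strictly_between (w a) (w b) (w k)) \<and>
    (a = - b \<or> \<not> (a < 0 \<and> 0 < b \<and> strictly_between (w a) (w b) 0))"
proof -
  have "(b, w b) = - (a, w a) \<longleftrightarrow> a = - b" using signed_uminus[OF w, of a] by auto
  moreover have "(a, w a) \<in> graph n w" "(b, w b) \<in> graph n w" using ab by (auto simp: graph_def)
  ultimately show ?thesis
    unfolding adj_def using ab(3) by (auto simp: graph_def in_box_def strictly_between_def[of a])
qed

lemma adj_graph_rise:
  assumes w: "w \<in> hyperoctahedral n" and ab: "a \<in> positions n" "b \<in> positions n" "a < b" "w a < w b"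
  shows "adj (graph n w) (a, w a) (b, w b) \<longleftrightarrow> free_rise n w a b"
  unfolding adj_graph_iff[OF w ab(1-3)] free_rise_def strictly_between_def using ab(4) by auto

text \<open>
Reflecting leaves the box unchanged and moves only its corners and their antipodes. An antipode of a
corner can be an obstacle only if the origin is one too.
\<close>

lemma adj_graph_comp:
  assumes u: "u \<in> hyperoctahedral n" and ab: "a \<in> positions n" "b \<in> positions n" "a < b" "u a < u b"
    and w: "w = u \<circ> signed_swap a b"
  shows "adj (graph n w) (a, w a) (b, w b) \<longleftrightarrow> free_rise n u a b"
proof -
  have w_mem: "w \<in> hyperoctahedral n" unfolding w by (intro hyperoctahedral_comp u signed_swap_mem ab)
  have wab: "w a = u b" "w b = u a" by (simp_all add: w signed_swap_def)
  have same: "w k = u k" if "k \<notin> {a, b, - a, - b}" for k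
    using that by (simp add: w signed_swap_def)
  show ?thesis
  proof (cases "a = - b \<or> \<not> (a < 0 \<and> 0 < b \<and> u a < 0 \<and> 0 < u b)")
    case False
    then show ?thesis
      unfolding adj_graph_iff[OF w_mem ab(1-3)] free_rise_def by (auto simp: strictly_between_def wab)
  next
    case True
    have "strictly_between (w a) (w b) (w k) \<longleftrightarrow> u a < u k \<and> u k < u b" if k: "a < k" "k < b" for k
    proof (cases "k \<in> {a, b, - a, - b}")
      case False
      then show ?thesis using same[of k] ab(4) by (auto simp: strictly_between_def wab)
    next
      case mirrored: True
      have "w (- a) = - u b" "w (- b) = - u a"
        using signed_uminus[OF w_mem] wab by simp_all
      then show ?thesis
        using mirrored k True ab(4) signed_uminus[OF u] by (auto simp: strictly_between_def wab)
    qed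
    then show ?thesis
      unfolding adj_graph_iff[OF w_mem ab(1-3)] free_rise_def using True ab(4)
      by (auto simp: strictly_between_def wab)
  qed
qed

definition cover_swaps :: "nat \<Rightarrow> (int \<Rightarrow> int) \<Rightarrow> (int \<Rightarrow> int) set" where
  "cover_swaps n w = {signed_swap a b |a b. a \<in> positions n \<and> b \<in> positions n \<and> a < b \<and> adj (graph n w) (a, w a) (b, w b)}"

lemma hasse_nbrs:
  assumes w: "w \<in> hyperoctahedral n" and n: "n \<ge> 1"
  shows "{u \<in> hyperoctahedral n. hasse_adj (hyperoctahedral n) (hyperoctahedral_gens n) w u} =
    (\<lambda>t. w \<circ> t) ` cover_swaps n w"
proof (intro equalityI subsetI)
  fix u assume "u \<in> {u \<in> hyperoctahedral n. hasse_adj (hyperoctahedral n) (hyperoctahedral_gens n) w u}"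
  then consider "bruhat_covers (hyperoctahedral n) (hyperoctahedral_gens n) w u"
    | "bruhat_covers (hyperoctahedral n) (hyperoctahedral_gens n) u w"
    by (auto simp: hasse_adj_def)
  then show "u \<in> (\<lambda>t. w \<circ> t) ` cover_swaps n w"
  proof cases
    case 1
    then obtain a b where ab: "u \<in> hyperoctahedral n" "a \<in> positions n" "b \<in> positions n" "a < b" "u a < u b"
      "free_rise n u a b" "w = u \<circ> signed_swap a b"
      unfolding bruhat_covers_iff[OF n] by blast
    have "u = w \<circ> signed_swap a b"
      unfolding ab(7) using ab(2,3) by (intro comp_signed_swap_twice[symmetric]) (auto simp: mem_positions)
    moreover have "signed_swap a b \<in> cover_swaps n w"
      unfolding cover_swaps_def using adj_graph_comp[OF ab(1-5,7)] ab(2-4,6) by blast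
    ultimately show ?thesis by blast
  next
    case 2
    then obtain a b where ab: "a \<in> positions n" "b \<in> positions n" "a < b" "w a < w b"
      "free_rise n w a b" "u = w \<circ> signed_swap a b"
      unfolding bruhat_covers_iff[OF n] by blast
    then have "signed_swap a b \<in> cover_swaps n w"
      unfolding cover_swaps_def using adj_graph_rise[OF w ab(1-4)] by blast
    then show ?thesis using ab(6) by blast
  qed
next
  fix u assume "u \<in> (\<lambda>t. w \<circ> t) ` cover_swaps n w"
  then obtain a b where ab: "a \<in> positions n" "b \<in> positions n" "a < b" and u: "u = w \<circ> signed_swap a b"
    and adj: "adj (graph n w) (a, w a) (b, w b)"
    unfolding cover_swaps_def by blast
  have u_mem: "u \<in> hyperoctahedral n" unfolding u by (intro hyperoctahedral_comp w signed_swap_mem ab)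
  \<comment> \<open>Whether \<open>u\<close> lies above or below \<open>w\<close> depends on the order of the two values.\<close>
  have w_eq: "w = u \<circ> signed_swap a b"
    unfolding u using ab by (intro comp_signed_swap_twice[symmetric]) (auto simp: mem_positions)
  have "hasse_adj (hyperoctahedral n) (hyperoctahedral_gens n) w u"
  proof (cases "w a < w b")
    case True
    then have "bruhat_covers (hyperoctahedral n) (hyperoctahedral_gens n) u w"
      unfolding bruhat_covers_iff[OF n] using w ab u adj adj_graph_rise[OF w ab] by blast
    then show ?thesis by (simp add: hasse_adj_def)
  next
    case False
    then have "w b < w a" using signed_eq_iff[OF w, of a b] ab(3) by simp
    then have "u a < u b" using ab(3) by (simp add: u signed_swap_def)
    then have "bruhat_covers (hyperoctahedral n) (hyperoctahedral_gens n) w u"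
      unfolding bruhat_covers_iff[OF n] using u_mem ab w_eq adj adj_graph_comp[OF u_mem ab _ w_eq] by blast
    then show ?thesis by (simp add: hasse_adj_def)
  qed
  then show "u \<in> {u \<in> hyperoctahedral n. hasse_adj (hyperoctahedral n) (hyperoctahedral_gens n) w u}"
    using u_mem by simp
qed

text \<open>
Reads off the orbit of points that belongs to a reflection, independently of the choice of \<open>a\<close> and \<open>b\<close>.
\<close>

definition moved_pairs :: "(int \<Rightarrow> int) \<Rightarrow> (int \<Rightarrow> int) \<Rightarrow> (int \<times> int) set set" where
  "moved_pairs w t = {{(x, w x), (t x, w (t x))} |x. t x \<noteq> x}"

lemma moved_pairs_signed_swap:
  assumes w: "w \<in> hyperoctahedral n" and ab: "a \<noteq> 0" "b \<noteq> 0" "a \<noteq> b"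
  shows "moved_pairs w (signed_swap a b) = orb (a, w a) (b, w b)"
proof -
  have fixes_iff: "signed_swap a b x \<noteq> x \<longleftrightarrow> x \<in> {a, b, - a, - b}" for x
    using ab by (auto simp: signed_swap_def)
  have "moved_pairs w (signed_swap a b) = (\<lambda>x. {(x, w x), (signed_swap a b x, w (signed_swap a b x))}) ` {a, b, - a, - b}"
    unfolding moved_pairs_def fixes_iff by blast
  also have "\<dots> = {{(a, w a), (b, w b)}, {(- a, w (- a)), (- b, w (- b))}}"
    using ab by (auto simp: signed_swap_def)
  finally show ?thesis by (simp add: orb_def signed_uminus[OF w])
qed

text \<open>
An involution is determined by the pairs of points that it exchanges.
\<close>

lemma moved_pairs_inject:
  assumes "\<And>x. t (t x) = x" "\<And>x. t' (t' x) = x" "moved_pairs w t = moved_pairs w t'"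
  shows "t = t'"
proof -
  have eq: "t' x = t x" if "t x \<noteq> x" "moved_pairs w t = moved_pairs w t'" "\<And>x. t' (t' x) = x" for t t' x
  proof -
    have "{(x, w x), (t x, w (t x))} \<in> moved_pairs w t"
      unfolding moved_pairs_def mem_Collect_eq using that(1) by (intro exI conjI) (rule refl)
    then have "{(x, w x), (t x, w (t x))} \<in> moved_pairs w t'" unfolding that(2) .
    then obtain z where "{(x, w x), (t x, w (t x))} = {(z, w z), (t' z, w (t' z))}"
      unfolding moved_pairs_def mem_Collect_eq by (elim exE conjE)
    then have "x = z \<and> t x = t' z \<or> x = t' z \<and> t x = z"
      unfolding doubleton_eq_iff prod.inject by iprover
    then show ?thesis
    proof (elim disjE conjE)
      assume "x = z" "t x = t' z"
      then show ?thesis by (simp only:)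
    next
      assume z: "x = t' z" "t x = z"
      have "t' x = z" unfolding z(1) by (rule that(3))
      then show ?thesis unfolding z(2) .
    qed
  qed
  show ?thesis
  proof
    fix x
    consider "t x \<noteq> x" | "t' x \<noteq> x" | "t x = x" "t' x = x" by blast
    then show "t x = t' x"
    proof cases
      case 1
      then show ?thesis using eq[OF _ assms(3,2), of x] by (simp only: not_False_eq_True)
    next
      case 2
      then show ?thesis using eq[OF _ assms(3)[symmetric] assms(1), of x] by (simp only: not_False_eq_True)
    qed (simp only:)
  qed
qed

lemma hasse_degree_eq:
  assumes w: "w \<in> hyperoctahedral n" and n: "n \<ge> 1"
  shows "hasse_degree (hyperoctahedral n) (hyperoctahedral_gens n) w = card (cover_swaps n w)"
    "card (cover_swaps n w) = card (edges (graph n w))"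
proof -
  have "inj_on (\<lambda>t. w \<circ> t) (cover_swaps n w)"
  proof (rule inj_onI)
    fix t t' assume "w \<circ> t = w \<circ> t'"
    then have "w (t x) = w (t' x)" for x by (metis comp_apply)
    then show "t = t'" using signed_eq_iff[OF w] by blast
  qed
  then show "hasse_degree (hyperoctahedral n) (hyperoctahedral_gens n) w = card (cover_swaps n w)"
    unfolding hasse_degree_def hasse_nbrs[OF w n] by (rule card_image)
  have "inj_on (moved_pairs w) (cover_swaps n w)"
  proof (rule inj_onI)
    have inv: "t (t x) = x" if "t \<in> cover_swaps n w" for t x
      using that unfolding cover_swaps_def by (auto simp: signed_swap_involution mem_positions)
    show "t = t'" if "t \<in> cover_swaps n w" "t' \<in> cover_swaps n w" "moved_pairs w t = moved_pairs w t'" for t t'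
      using moved_pairs_inject[OF inv[OF that(1)] inv[OF that(2)] that(3)] .
  qed
  moreover have "moved_pairs w ` cover_swaps n w = edges (graph n w)"
  proof (intro equalityI subsetI)
    fix e assume "e \<in> moved_pairs w ` cover_swaps n w"
    then obtain a b where ab: "a \<in> positions n" "b \<in> positions n" "a < b" "adj (graph n w) (a, w a) (b, w b)"
      "e = moved_pairs w (signed_swap a b)"
      unfolding cover_swaps_def by blast
    have "e = orb (a, w a) (b, w b)"
      unfolding ab(5) using ab(1-3) by (intro moved_pairs_signed_swap[OF w]) (auto simp: mem_positions)
    then show "e \<in> edges (graph n w)" using edgesI[OF ab(4)] by simp
  next
    fix e assume "e \<in> edges (graph n w)"
    then obtain p q where e: "e = orb p q" and pq: "adj (graph n w) p q" by (rule edgesE)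
    then obtain c d where c: "c \<in> positions n" "p = (c, w c)" and d: "d \<in> positions n" "q = (d, w d)"
      using adj_in[OF pq] unfolding graph_def by blast
    have "c \<noteq> d" using adj_in[OF pq] c d by blast
    have adj': "adj (graph n w) (c, w c) (d, w d)" "adj (graph n w) (d, w d) (c, w c)"
      using pq adj_commute[of "graph n w" p q] unfolding c d by blast+
    obtain a b where ab: "a \<in> positions n" "b \<in> positions n" "a < b" "adj (graph n w) (a, w a) (b, w b)"
      "e = orb (a, w a) (b, w b)"
    proof (cases "c < d")
      case True
      then show ?thesis using that[of c d] c d adj'(1) e by blast
    next
      case False
      then have "d < c" using \<open>c \<noteq> d\<close> by simp
      then show ?thesis using that[of d c] c d adj'(2) e orb_commute by metis
    qed
    have "e = moved_pairs w (signed_swap a b)"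
      unfolding ab(5) using ab(1-3) by (intro moved_pairs_signed_swap[OF w, symmetric]) (auto simp: mem_positions)
    then show "e \<in> moved_pairs w ` cover_swaps n w" unfolding cover_swaps_def using ab(1-4) by blast
  qed
  ultimately show "card (cover_swaps n w) = card (edges (graph n w))" by (metis card_image)
qed

section \<open>An extremal signed permutation\<close>

text \<open>
Under the normalisation \<open>0 \<le> a + b\<close> the larger position \<open>b\<close> is the largest point moved by the reflection.
\<close>

lemma signed_swap_inject:
  assumes "a < b" "0 \<le> a + b" "c < d" "0 \<le> c + d" "signed_swap a b = signed_swap c d"
  shows "a = c \<and> b = d"
proof -
  have "signed_swap c d b = a" using assms by (simp add: signed_swap_def flip: assms(5))
  moreover have "signed_swap a b d = c" using assms(1-4) by (simp add: assms(5) signed_swap_def)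
  ultimately show ?thesis
    using assms(1-4) by (auto simp: signed_swap_def split: if_splits)
qed

text \<open>
The one-line notation is \<open>1, \<dots>, m, -n, \<dots>, -(m + 1)\<close>.
\<close>

definition extremal :: "nat \<Rightarrow> nat \<Rightarrow> int \<Rightarrow> int" where
  "extremal n m x = (if int m < x \<and> x \<le> int n then x - (int n + int m + 1)
     else if - int n \<le> x \<and> x < - int m then x + (int n + int m + 1) else x)"

lemma extremal_mem: "extremal n m \<in> hyperoctahedral n"
proof -
  have inv: "extremal n m (extremal n m x) = x" for x by (auto simp: extremal_def)
  have "extremal n m permutes positions n"
    unfolding permutes_def
  proof (intro conjI allI impI)
    show "extremal n m x = x" if "x \<notin> positions n" for x
      using that by (auto simp: extremal_def mem_positions)
    show "\<exists>!x. extremal n m x = y" for y using inv by metis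
  qed
  then show ?thesis by (auto simp: hyperoctahedral_iff extremal_def)
qed

text \<open>
For positions \<open>i \<le> m < j\<close> both \<open>(i, j)\<close> and \<open>(-i, j)\<close> give covers, which are the sets \<open>?A\<close> and \<open>?B\<close>. The
set \<open>?C\<close> holds neighbouring positions with values of equal sign, and \<open>?D\<close> the sign change at position \<open>1\<close>.
\<close>

lemma extremal_degree:
  assumes m: "1 \<le> m" "m < n"
  shows "2 * (m * (n - m)) + (n - 1) \<le> card (cover_swaps n (extremal n m))"
proof -
  let ?w = "extremal n m"
  let ?A = "{1..int m} \<times> {int m + 1..int n}"
  let ?B = "(\<lambda>(i, j). (- i, j)) ` ?A"
  let ?C = "(\<lambda>i. (i, i + 1)) ` ({1..int n - 1} - {int m})"
  let ?D = "{(- 1, 1)} :: (int \<times> int) set"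
  let ?Q = "?A \<union> ?B \<union> ?C \<union> ?D"
  have Q: "a \<in> positions n \<and> b \<in> positions n \<and> a < b \<and> 0 \<le> a + b \<and> adj (graph n ?w) (a, ?w a) (b, ?w b)"
    if "(a, b) \<in> ?Q" for a b
  proof -
    have ab: "a \<in> positions n" "b \<in> positions n" "a < b" "0 \<le> a + b" using that m by (auto simp: mem_positions)
    from that consider "1 \<le> a" "a \<le> int m" "int m + 1 \<le> b" "b \<le> int n"
      | "1 \<le> - a" "- a \<le> int m" "int m + 1 \<le> b" "b \<le> int n"
      | "b = a + 1" "1 \<le> a" | "a = - 1" "b = 1"
      by auto
    then have "adj (graph n ?w) (a, ?w a) (b, ?w b)"
      unfolding adj_graph_iff[OF extremal_mem ab(1-3)] using m
      by cases (auto simp: strictly_between_def extremal_def mem_positions)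
    with ab show ?thesis by blast
  qed
  have "inj_on (\<lambda>(a, b). signed_swap a b) ?Q"
  proof (rule inj_onI)
    fix p q assume pq: "p \<in> ?Q" "q \<in> ?Q" "(\<lambda>(a, b). signed_swap a b) p = (\<lambda>(a, b). signed_swap a b) q"
    obtain a b c d where "p = (a, b)" "q = (c, d)" by fastforce
    then show "p = q" using signed_swap_inject[of a b c d] Q[of a b] Q[of c d] pq by auto
  qed
  then have "card ?Q = card ((\<lambda>(a, b). signed_swap a b) ` ?Q)" by (rule card_image[symmetric])
  also have "\<dots> \<le> card (cover_swaps n ?w)"
  proof (rule card_mono)
    have "cover_swaps n ?w \<subseteq> (\<lambda>(a, b). signed_swap a b) ` (positions n \<times> positions n)"
      unfolding cover_swaps_def by auto
    then show "finite (cover_swaps n ?w)" by (rule finite_subset) (simp add: positions_def)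
    show "(\<lambda>(a, b). signed_swap a b) ` ?Q \<subseteq> cover_swaps n ?w"
    proof
      fix t assume "t \<in> (\<lambda>(a, b). signed_swap a b) ` ?Q"
      then obtain p where p: "p \<in> ?Q" "t = (\<lambda>(a, b). signed_swap a b) p" by (rule imageE)
      obtain a b where "p = (a, b)" by fastforce
      with p have "(a, b) \<in> ?Q" "t = signed_swap a b" by simp_all
      then show "t \<in> cover_swaps n ?w" unfolding cover_swaps_def using Q[of a b] by blast
    qed
  qed
  finally have "card ?Q \<le> card (cover_swaps n ?w)" .
  moreover have "card ?Q = 2 * (m * (n - m)) + (n - 1)"
  proof -
    have "card ?A = m * (n - m)" using m by (simp add: card_cartesian_product nat_diff_distrib)
    moreover have "card ?B = card ?A" by (intro card_image) (auto simp: inj_on_def)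
    moreover have "card ?C = n - 2"
    proof -
      have "card ?C = card ({1..int n - 1} - {int m})" by (intro card_image) (auto simp: inj_on_def)
      also have "\<dots> = n - 2" using m by (subst card_Diff_singleton) auto
      finally show ?thesis .
    qed
    moreover have "card ?Q = card ?A + card ?B + card ?C + card ?D"
    proof -
      have "card ?Q = card (?A \<union> ?B \<union> ?C) + card ?D" by (intro card_Un_disjoint) auto
      also have "card (?A \<union> ?B \<union> ?C) = card (?A \<union> ?B) + card ?C" by (intro card_Un_disjoint) auto
      also have "card (?A \<union> ?B) = card ?A + card ?B" by (intro card_Un_disjoint) auto
      finally show ?thesis .
    qed
    moreover have "card ?D = 1" by simp
    ultimately show ?thesis using m by linarith
  qed
  ultimately show ?thesis by linarith
qed

section \<open>The maximum degree\<close>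

theorem theorem21:
  fixes n :: nat
  assumes "n \<ge> 5"
  shows "int (Max (hasse_degree (hyperoctahedral n) (hyperoctahedral_gens n) ` hyperoctahedral n))
           = \<lfloor>(real n)\<^sup>2 / 2\<rfloor> + int n - 1"
proof -
  let ?d = "hasse_degree (hyperoctahedral n) (hyperoctahedral_gens n)"
  have n: "n \<ge> 1" using assms by simp
  define m where "m = n div 2"
  have m: "1 \<le> m" "m < n" using assms by (auto simp: m_def)
  have le: "?d w \<le> n\<^sup>2 div 2 + n - 1" if "w \<in> hyperoctahedral n" for w
    unfolding hasse_degree_eq[OF that n]
    using card_edges_le[OF assms diagram_graph[OF that]] .
  have "2 * (m * (n - m)) = n\<^sup>2 div 2"
  proof (cases "even n")
    case True
    then obtain k where "n = 2 * k" by (elim evenE)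
    then show ?thesis by (simp add: m_def power2_eq_square)
  next
    case False
    then obtain k where "n = 2 * k + 1" by (elim oddE)
    then show ?thesis by (simp add: m_def power2_eq_square algebra_simps)
  qed
  then have ge: "n\<^sup>2 div 2 + n - 1 \<le> ?d (extremal n m)"
    using extremal_degree[OF m] m unfolding hasse_degree_eq(1)[OF extremal_mem n] by linarith
  have "Max (?d ` hyperoctahedral n) = n\<^sup>2 div 2 + n - 1"
  proof (rule Max_eqI)
    show "finite (?d ` hyperoctahedral n)" by (intro finite_imageI finite_hyperoctahedral)
    show "n\<^sup>2 div 2 + n - 1 \<in> ?d ` hyperoctahedral n"
      using ge le[OF extremal_mem] extremal_mem by (metis image_eqI le_antisym)
  qed (use le in auto)
  moreover have "\<lfloor>(real n)\<^sup>2 / 2\<rfloor> = int (n\<^sup>2 div 2)"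
    using floor_divide_of_nat_eq[of "n\<^sup>2" 2, where 'a = real] by simp
  ultimately show ?thesis using n by simp
qed

end
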